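(* Let $(X,\mu,\mathcal{E},\mathcal{F})$ be a Dirichlet space with conservative heat semigroup $\{P_t\}_{t\in[0,\infty)}$. Suppose that every $f\in\mathcal F$ with $\mathcal E(f,f)=0$ is constant. If $\mathcal E$ is regular and the energy measure $\nu_f$ is singular to $\mu$ for any non-constant $f\in\mathcal F$, then the space $\mathbf B^{p,1/2}(X)$ contains only constant functions when $p>2$.
   Context: $X$ is a good measurable space (the measure decomposition theorem holds and the $\sigma$-algebra is generated by a countable family; e.g. a Polish space) with a $\sigma$-finite measure $\mu$. A Dirichlet form is a densely defined closed symmetric form $(\mathcal{E},\mathcal{F})$ on $L^2(X,\mu)$ which is Markovian: if $u\in\mathcal F$ and $v$ satisfies $|v(x)-v(y)|\le|u(x)-u(y)|$ and $|v(x)|\le|u(x)|$ for a.e. $x,y$, then $v\in\mathcal F$ and $\mathcal E(v,v)\le\mathcal E(u,u)$. Then $(X,\mu,\mathcal E,\mathcal F)$ is called a Dirichlet space. $\{P_t\}_{t\ge0}$ is the associated self-adjoint sub-Markovian semigroup on $L^2(X,\mu)$ (the heat semigroup), extended to a contraction semigroup on every $L^p(X,\mu)$, $1\le p\le\infty$. It is conservative if $P_t1=1$ for all $t$; then there are probability kernels $p_t(x,dy)$ with $P_tf(x)=\int_Xf(y)\,p_t(x,dy)$ for bounded or non-negative measurable $f$. For $p\ge1$, $\alpha\ge0$, $f\in L^p(X,\mu)$, $$\|f\|_{p,\alpha}=\sup_{t>0}t^{-\alpha}\left(\int_X\int_X|f(x)-f(y)|^p\,p_t(y,dx)\,d\mu(y)\right)^{1/p},$$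 and $\mathbf B^{p,\alpha}(X)=\{f\in L^p(X,\mu):\|f\|_{p,\alpha}<+\infty\}$. The Dirichlet space is regular if $X$ is a locally compact topological space, $\mu$ is a Radon measure with support $X$, and there is a core, i.e. a subset of $C_c(X)\cap\mathcal F$ dense in $C_c(X)$ in supremum norm and dense in $\mathcal F$ for the norm $(\|f\|_{L^2}^2+\mathcal E(f,f))^{1/2}$. For regular $\mathcal E$ and $f\in\mathcal F\cap L^\infty(X,\mu)$ the energy measure $\nu_f$ is the Radon measure defined by $\int_X\phi\,d\nu_f=\mathcal E(f\phi,f)-\frac12\mathcal E(\phi,f^2)$ for $\phi\in\mathcal F\cap C_c(X)$; for general $f\in\mathcal F$, $\nu_f$ is the weak limit of $\nu_{f_n}$ with $f_n=\max\{-n,\min\{n,f\}\}$. *)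

theory Defs
  imports "HOL-Probability.Probability"
begin

section \<open>Measure-theoretic preliminaries\<close>

text \<open>Elements of the Lebesgue spaces are represented by measurable real-valued functions.
  The spaces are closed under a.e. equality, and everything below respects a.e. equality.\<close>

definition Lp :: "'a measure \<Rightarrow> real \<Rightarrow> ('a \<Rightarrow> real) set" where
  "Lp M p = {f \<in> borel_measurable M. integrable M (\<lambda>x. \<bar>f x\<bar> powr p)}"

definition Lp_norm :: "'a measure \<Rightarrow> real \<Rightarrow> ('a \<Rightarrow> real) \<Rightarrow> real" where
  "Lp_norm M p f = (\<integral>x. \<bar>f x\<bar> powr p \<partial>M) powr (1 / p)"

definition Linf :: "'a measure \<Rightarrow> ('a \<Rightarrow> real) set" where
  "Linf M = {f \<in> borel_measurable M. \<exists>C. AE x in M. \<bar>f x\<bar> \<le> C}"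

definition lebesgue_spaces :: "'a measure \<Rightarrow> ('a \<Rightarrow> real) set set" where
  "lebesgue_spaces M = insert (Linf M) (Lp M ` {1..})"

definition ae_constant :: "'a measure \<Rightarrow> ('a \<Rightarrow> real) \<Rightarrow> bool" where
  "ae_constant M f \<longleftrightarrow> (\<exists>c. AE x in M. f x = c)"

definition mutually_singular :: "'a measure \<Rightarrow> 'a measure \<Rightarrow> bool" where
  "mutually_singular M N \<longleftrightarrow>
     sets M = sets N \<and> (\<exists>A\<in>sets M. emeasure M A = 0 \<and> emeasure N (space N - A) = 0)"

text \<open>The second conjunct is the measure decomposition theorem: a probability measure on the
  product space disintegrates over its first marginal through a probability kernel.\<close>

definition good_measurable_space :: "'a measure \<Rightarrow> bool" where
  "good_measurable_space M \<longleftrightarrow>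
     (\<exists>G. countable G \<and> G \<subseteq> Pow (space M) \<and> sets M = sigma_sets (space M) G) \<and>
     (\<forall>N. prob_space N \<and> sets N = sets (M \<Otimes>\<^sub>M M) \<longrightarrow>
        (\<exists>k \<in> measurable M (prob_algebra M). \<forall>A\<in>sets (M \<Otimes>\<^sub>M M).
           emeasure N A = (\<integral>\<^sup>+x. emeasure (k x) (Pair x -` A) \<partial>distr N M fst)))"

text \<open>Radon measures in the sense of the Riesz representation theorem.\<close>

definition radon_measure :: "'a::t2_space measure \<Rightarrow> bool" where
  "radon_measure M \<longleftrightarrow>
     sets M = sets borel \<and>
     (\<forall>K. compact K \<longrightarrow> emeasure M K < \<infinity>) \<and>
     (\<forall>A\<in>sets borel. emeasure M A = (INF U\<in>{U. open U \<and> A \<subseteq> U}. emeasure M U)) \<and>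
     (\<forall>U. open U \<longrightarrow> emeasure M U = (SUP K\<in>{K. compact K \<and> K \<subseteq> U}. emeasure M K))"

definition measure_support :: "'a::topological_space measure \<Rightarrow> 'a set" where
  "measure_support M = {x. \<forall>U. open U \<and> x \<in> U \<longrightarrow> 0 < emeasure M U}"

definition C_c :: "('a::topological_space \<Rightarrow> real) set" where
  "C_c = {f. continuous_on UNIV f \<and> compact (closure {x. f x \<noteq> 0})}"


section \<open>Dirichlet spaces and their heat semigroups\<close>

definition energy_norm ::
  "'a measure \<Rightarrow> (('a \<Rightarrow> real) \<Rightarrow> ('a \<Rightarrow> real) \<Rightarrow> real) \<Rightarrow> ('a \<Rightarrow> real) \<Rightarrow> real" where
  "energy_norm M E f = sqrt ((Lp_norm M 2 f)\<^sup>2 + E f f)"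

text \<open>Only the values of \<open>E\<close> on \<open>F \<times> F\<close> matter. The assumptions \<open>dom_cong\<close> and \<open>form_cong\<close> say
  that \<open>F\<close> and \<open>E\<close> live on a.e. equivalence classes.\<close>

locale dirichlet_space = sigma_finite_measure M
  for M :: "'a measure"
    and E :: "('a \<Rightarrow> real) \<Rightarrow> ('a \<Rightarrow> real) \<Rightarrow> real"
    and F :: "('a \<Rightarrow> real) set" +
  assumes dom_L2: "F \<subseteq> Lp M 2"
    and dom_cong: "\<lbrakk>f \<in> F; g \<in> borel_measurable M; AE x in M. f x = g x\<rbrakk> \<Longrightarrow> g \<in> F"
    and form_cong: "\<lbrakk>f \<in> F; g \<in> F; h \<in> F; AE x in M. f x = g x\<rbrakk> \<Longrightarrow> E f h = E g h"
    and dom_zero: "(\<lambda>_. 0) \<in> F"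
    and dom_lin: "\<lbrakk>f \<in> F; g \<in> F\<rbrakk> \<Longrightarrow> (\<lambda>x. a * f x + b * g x) \<in> F"
    and form_lin: "\<lbrakk>f \<in> F; g \<in> F; h \<in> F\<rbrakk> \<Longrightarrow> E (\<lambda>x. a * f x + b * g x) h = a * E f h + b * E g h"
    and form_sym: "\<lbrakk>f \<in> F; g \<in> F\<rbrakk> \<Longrightarrow> E f g = E g f"
    and form_nonneg: "f \<in> F \<Longrightarrow> 0 \<le> E f f"
    and densely_defined:
      "\<lbrakk>f \<in> Lp M 2; 0 < e\<rbrakk> \<Longrightarrow> \<exists>g\<in>F. Lp_norm M 2 (\<lambda>x. f x - g x) < e"
    and closed:
      "\<And>u :: nat \<Rightarrow> 'a \<Rightarrow> real.
         \<lbrakk>\<And>n. u n \<in> F;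
          \<And>e. 0 < e \<Longrightarrow> \<exists>N. \<forall>m\<ge>N. \<forall>n\<ge>N. energy_norm M E (\<lambda>x. u m x - u n x) < e\<rbrakk>
         \<Longrightarrow> \<exists>v\<in>F. (\<lambda>n. energy_norm M E (\<lambda>x. u n x - v x)) \<longlonglongrightarrow> 0"
    and markovian:
      "\<lbrakk>u \<in> F; v \<in> borel_measurable M;
        AE x in M. AE y in M. \<bar>v x - v y\<bar> \<le> \<bar>u x - u y\<bar>; AE x in M. \<bar>v x\<bar> \<le> \<bar>u x\<bar>\<rbrakk>
       \<Longrightarrow> v \<in> F \<and> E v v \<le> E u u"

text \<open>The assumption \<open>generator\<close> says that the infinitesimal generator of the semigroup on
  \<open>L\<^sup>2\<close> is the operator \<open>L\<close> of the form, given by \<open>E f h = - \<langle>L f, h\<rangle>\<close>.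
  The operators act on all spaces \<open>L\<^sup>p\<close>, \<open>1 \<le> p \<le> \<infinity>\<close>, and \<open>duality\<close> is what pins down the
  extension to \<open>L\<^sup>\<infinity>\<close>.\<close>

locale heat_semigroup = dirichlet_space M E F
  for M :: "'a measure"
    and E :: "('a \<Rightarrow> real) \<Rightarrow> ('a \<Rightarrow> real) \<Rightarrow> real"
    and F :: "('a \<Rightarrow> real) set"
    and P :: "real \<Rightarrow> ('a \<Rightarrow> real) \<Rightarrow> 'a \<Rightarrow> real" +
  assumes closed_under: "\<lbrakk>0 \<le> t; V \<in> lebesgue_spaces M; f \<in> V\<rbrakk> \<Longrightarrow> P t f \<in> V"
    and linear:
      "\<lbrakk>0 \<le> t; V \<in> lebesgue_spaces M; f \<in> V; g \<in> V\<rbrakk>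
       \<Longrightarrow> AE x in M. P t (\<lambda>x. a * f x + b * g x) x = a * P t f x + b * P t g x"
    and at_0: "\<lbrakk>V \<in> lebesgue_spaces M; f \<in> V\<rbrakk> \<Longrightarrow> AE x in M. P 0 f x = f x"
    and semigroup:
      "\<lbrakk>0 \<le> s; 0 \<le> t; V \<in> lebesgue_spaces M; f \<in> V\<rbrakk>
       \<Longrightarrow> AE x in M. P (s + t) f x = P s (P t f) x"
    and contraction_Lp: "\<lbrakk>0 \<le> t; 1 \<le> p; f \<in> Lp M p\<rbrakk> \<Longrightarrow> Lp_norm M p (P t f) \<le> Lp_norm M p f"
    and contraction_Linf:
      "\<lbrakk>0 \<le> t; f \<in> Linf M; AE x in M. \<bar>f x\<bar> \<le> C\<rbrakk> \<Longrightarrow> AE x in M. \<bar>P t f x\<bar> \<le> C"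
    and self_adjoint:
      "\<lbrakk>0 \<le> t; f \<in> Lp M 2; g \<in> Lp M 2\<rbrakk>
       \<Longrightarrow> (\<integral>x. P t f x * g x \<partial>M) = (\<integral>x. f x * P t g x \<partial>M)"
    and duality:
      "\<lbrakk>0 \<le> t; f \<in> Linf M; g \<in> Lp M 1\<rbrakk>
       \<Longrightarrow> (\<integral>x. P t f x * g x \<partial>M) = (\<integral>x. f x * P t g x \<partial>M)"
    and sub_markovian:
      "\<lbrakk>0 \<le> t; f \<in> Lp M 2; AE x in M. 0 \<le> f x \<and> f x \<le> 1\<rbrakk>
       \<Longrightarrow> AE x in M. 0 \<le> P t f x \<and> P t f x \<le> 1"
    and strongly_continuous:
      "f \<in> Lp M 2 \<Longrightarrow> ((\<lambda>t. Lp_norm M 2 (\<lambda>x. P t f x - f x)) \<longlongrightarrow> 0) (at_right 0)"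
    and generator:
      "\<lbrakk>f \<in> Lp M 2; g \<in> Lp M 2\<rbrakk>
       \<Longrightarrow> ((\<lambda>t. Lp_norm M 2 (\<lambda>x. (P t f x - f x) / t - g x)) \<longlongrightarrow> 0) (at_right 0) \<longleftrightarrow>
           f \<in> F \<and> (\<forall>h\<in>F. E f h = - (\<integral>x. g x * h x \<partial>M))"

definition conservative :: "'a measure \<Rightarrow> (real \<Rightarrow> ('a \<Rightarrow> real) \<Rightarrow> 'a \<Rightarrow> real) \<Rightarrow> bool" where
  "conservative M P \<longleftrightarrow> (\<forall>t\<ge>0. AE x in M. P t (\<lambda>_. 1) x = 1)"

definition heat_kernel ::
  "'a measure \<Rightarrow> (real \<Rightarrow> ('a \<Rightarrow> real) \<Rightarrow> 'a \<Rightarrow> real) \<Rightarrow> (real \<Rightarrow> 'a \<Rightarrow> 'a measure) \<Rightarrow> bool" where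
  "heat_kernel M P k \<longleftrightarrow>
     (\<forall>t\<ge>0. k t \<in> measurable M (prob_algebra M) \<and>
        (\<forall>f\<in>borel_measurable M. bounded (f ` space M) \<longrightarrow>
           (AE x in M. P t f x = (\<integral>y. f y \<partial>k t x))) \<and>
        (\<forall>V\<in>lebesgue_spaces M. \<forall>f\<in>V. (\<forall>x\<in>space M. 0 \<le> f x) \<longrightarrow>
           (AE x in M. ennreal (P t f x) = (\<integral>\<^sup>+y. ennreal (f y) \<partial>k t x))))"


section \<open>Besov spaces\<close>

text \<open>Used only for exponents \<open>a > 0\<close>.\<close>

definition ennreal_powr :: "ennreal \<Rightarrow> real \<Rightarrow> ennreal" where
  "ennreal_powr x a = (if x = \<infinity> then \<infinity> else ennreal (enn2real x powr a))"

definition besov_seminorm ::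
  "'a measure \<Rightarrow> (real \<Rightarrow> 'a \<Rightarrow> 'a measure) \<Rightarrow> real \<Rightarrow> real \<Rightarrow> ('a \<Rightarrow> real) \<Rightarrow> ennreal" where
  "besov_seminorm M k p \<alpha> f =
     (SUP t\<in>{0<..}. ennreal (t powr - \<alpha>) *
        ennreal_powr (\<integral>\<^sup>+y. (\<integral>\<^sup>+x. ennreal (\<bar>f x - f y\<bar> powr p) \<partial>k t y) \<partial>M) (1 / p))"

definition besov_space ::
  "'a measure \<Rightarrow> (real \<Rightarrow> 'a \<Rightarrow> 'a measure) \<Rightarrow> real \<Rightarrow> real \<Rightarrow> ('a \<Rightarrow> real) set" where
  "besov_space M k p \<alpha> = {f \<in> Lp M p. besov_seminorm M k p \<alpha> f < \<infinity>}"


section \<open>Regularity and energy measures\<close>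

definition is_core ::
  "'a::topological_space measure \<Rightarrow> (('a \<Rightarrow> real) \<Rightarrow> ('a \<Rightarrow> real) \<Rightarrow> real) \<Rightarrow> ('a \<Rightarrow> real) set
     \<Rightarrow> ('a \<Rightarrow> real) set \<Rightarrow> bool" where
  "is_core M E F D \<longleftrightarrow>
     D \<subseteq> C_c \<inter> F \<and>
     (\<forall>f\<in>C_c. \<forall>e>0. \<exists>g\<in>D. \<forall>x. \<bar>f x - g x\<bar> < e) \<and>
     (\<forall>f\<in>F. \<forall>e>0. \<exists>g\<in>D. energy_norm M E (\<lambda>x. f x - g x) < e)"

definition regular_form ::
  "'a::t2_space measure \<Rightarrow> (('a \<Rightarrow> real) \<Rightarrow> ('a \<Rightarrow> real) \<Rightarrow> real) \<Rightarrow> ('a \<Rightarrow> real) set \<Rightarrow> bool" where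
  "regular_form M E F \<longleftrightarrow>
     locally_compact_space (euclidean :: 'a topology) \<and>
     radon_measure M \<and> measure_support M = UNIV \<and> (\<exists>D. is_core M E F D)"

definition bounded_energy_measure ::
  "(('a::t2_space \<Rightarrow> real) \<Rightarrow> ('a \<Rightarrow> real) \<Rightarrow> real) \<Rightarrow> ('a \<Rightarrow> real) set
     \<Rightarrow> ('a \<Rightarrow> real) \<Rightarrow> 'a measure \<Rightarrow> bool" where
  "bounded_energy_measure E F f \<nu> \<longleftrightarrow>
     radon_measure \<nu> \<and>
     (\<forall>\<phi>\<in>F \<inter> C_c. (\<integral>x. \<phi> x \<partial>\<nu>) = E (\<lambda>x. f x * \<phi> x) f - E \<phi> (\<lambda>x. (f x)\<^sup>2) / 2)"

text \<open>\<open>energy_measure M E F f \<nu>\<close> says that \<open>\<nu>\<close> is the energy measure \<open>\<nu>\<^sub>f\<close>.\<close>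

definition energy_measure ::
  "'a::t2_space measure \<Rightarrow> (('a \<Rightarrow> real) \<Rightarrow> ('a \<Rightarrow> real) \<Rightarrow> real) \<Rightarrow> ('a \<Rightarrow> real) set
     \<Rightarrow> ('a \<Rightarrow> real) \<Rightarrow> 'a measure \<Rightarrow> bool" where
  "energy_measure M E F f \<nu> \<longleftrightarrow>
     (if f \<in> Linf M then bounded_energy_measure E F f \<nu>
      else radon_measure \<nu> \<and>
        (\<exists>\<nu>s :: nat \<Rightarrow> 'a measure.
           (\<forall>n. bounded_energy_measure E F (\<lambda>x. max (- real n) (min (real n) (f x))) (\<nu>s n)) \<and>
           (\<forall>\<phi>::'a \<Rightarrow> real. continuous_on UNIV \<phi> \<and> bounded (range \<phi>) \<longrightarrow>
              (\<lambda>n. \<integral>x. \<phi> x \<partial>\<nu>s n) \<longlonglongrightarrow> (\<integral>x. \<phi> x \<partial>\<nu>))))"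

end

theory Submission
  imports Defs
begin

text \<open>A Besov function need not lie in \<open>L\<^sup>2\<close>, so it is replaced by bounded truncations \<open>h\<close> that vanish
  near the value 0 and hence have support of finite measure; these are contractions of \<open>f\<close> and keep
  the bound \<open>\<integral>\<integral> |h x - h y|\<^sup>p p\<^sub>t(y,dx) d\<mu>(y) \<le> C t\<^bsup>p/2\<^esup>\<close>. As \<open>p > 2\<close>, this bound makes the densities
  \<open>t\<^bsup>-1\<^esup> \<integral> (h x - h y)\<^sup>2 p\<^sub>t(y,dx)\<close> bounded in \<open>L\<^sup>1\<close> on sets of finite measure and uniformly integrable.
  Boundedness gives \<open>h \<in> F\<close>; uniform integrability shows that \<open>\<nu>\<^sub>h\<close> does not charge \<open>\<mu>\<close>-null sets,
  so that \<open>\<nu>\<^sub>h = 0\<close> if \<open>h\<close> is not constant, and that no energy escapes from the supports of the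
  cut-off functions, so that \<open>E(h,h) = 0\<close>. The link between form and semigroup is
  \<open>E(f,g) = lim t\<^bsup>-1\<^esup> \<langle>f - P\<^sub>t f, g\<rangle>\<close>, which follows from the description of the generator by
  approximating in the energy norm with resolvents of the form, without spectral theory.\<close>

section \<open>Semi-inner products on spaces of functions\<close>

text \<open>The obstacle: the energy measure is known only through test functions in
  \<open>F \<inter> C_c\<close>, while \<open>E h h\<close> is a limit of double integrals over all
  of \<open>X\<close>, which need not be compact. Two gaps, one estimate: cutting the squared
  differences at height \<open>t * \<kappa>\<close> bounds the energy seen by a weight
  \<open>\<psi>\<close> by \<open>\<kappa> * \<integral>\<psi> + \<kappa> powr (1 - r) * C\<close>,
  where \<open>r = p / 2\<close>. If \<open>\<psi>\<close> has integral at most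
  \<open>\<kappa> powr - r\<close>, both terms have order \<open>\<kappa> powr (1 - r)\<close>,
  which tends to 0 as \<open>\<kappa>\<close> grows because \<open>p > 2\<close>. The weight lives
  first near the null set carrying the energy measure, then in the gap between a cut-off function
  and an open set around the points where \<open>h\<close> is nonzero. Two inequalities stand in for
  the spectral theorem: the quotient \<open>\<langle>f - P t f, f\<rangle> / t\<close> does not
  decrease when \<open>t\<close> is halved, and on \<open>F\<close> it is at most
  \<open>E f f\<close>, which makes approximation by resolvents uniform in \<open>t\<close>. The
  locale has three instances: the inner product of L2, the form, and the approximating forms. None
  of them need be definite on functions.\<close>

locale semi_inner =
  fixes S :: "('a \<Rightarrow> real) set" and Q :: "('a \<Rightarrow> real) \<Rightarrow> ('a \<Rightarrow> real) \<Rightarrow> real"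
  assumes lin_closed: "\<lbrakk>f \<in> S; g \<in> S\<rbrakk> \<Longrightarrow> (\<lambda>x. a * f x + b * g x) \<in> S"
    and lin_left: "\<lbrakk>f \<in> S; g \<in> S; h \<in> S\<rbrakk> \<Longrightarrow> Q (\<lambda>x. a * f x + b * g x) h = a * Q f h + b * Q g h"
    and sym: "\<lbrakk>f \<in> S; g \<in> S\<rbrakk> \<Longrightarrow> Q f g = Q g f"
    and nonneg: "f \<in> S \<Longrightarrow> 0 \<le> Q f f"
begin

lemma lin_right:
  "\<lbrakk>f \<in> S; g \<in> S; h \<in> S\<rbrakk> \<Longrightarrow> Q h (\<lambda>x. a * f x + b * g x) = a * Q h f + b * Q h g"
  using lin_left[of f g h a b] lin_closed[of f g a b] sym by metis

lemma diff_closed: "\<lbrakk>f \<in> S; g \<in> S\<rbrakk> \<Longrightarrow> (\<lambda>x. f x - g x) \<in> S"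
  using lin_closed[of f g 1 "-1"] by simp

lemma diff_left: "\<lbrakk>f \<in> S; g \<in> S; h \<in> S\<rbrakk> \<Longrightarrow> Q (\<lambda>x. f x - g x) h = Q f h - Q g h"
  using lin_left[of f g h 1 "-1"] by simp

lemma diff_right: "\<lbrakk>f \<in> S; g \<in> S; h \<in> S\<rbrakk> \<Longrightarrow> Q h (\<lambda>x. f x - g x) = Q h f - Q h g"
  using lin_right[of f g h 1 "-1"] by simp

lemma lin_self:
  assumes "f \<in> S" "g \<in> S"
  shows "Q (\<lambda>x. a * f x + b * g x) (\<lambda>x. a * f x + b * g x)
           = a\<^sup>2 * Q f f + 2 * a * b * Q f g + b\<^sup>2 * Q g g"
  using assms sym[of g f]
  by (simp add: lin_left lin_right lin_closed algebra_simps power2_eq_square)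

lemma diff_self:
  assumes "f \<in> S" "g \<in> S"
  shows "Q (\<lambda>x. f x - g x) (\<lambda>x. f x - g x) = Q f f - 2 * Q f g + Q g g"
  using lin_self[OF assms, of 1 "-1"] by simp

lemma cauchy_schwarz:
  assumes f: "f \<in> S" and g: "g \<in> S"
  shows "(Q f g)\<^sup>2 \<le> Q f f * Q g g"
proof (cases "Q g g = 0")
  case True
  have *: "0 \<le> Q f f + 2 * s * Q f g" for s
    using nonneg[OF lin_closed[OF f g, of 1 s]] lin_self[OF f g, of 1 s] True by simp
  have "Q f g = 0"
  proof (rule ccontr)
    assume "Q f g \<noteq> 0"
    \<comment> \<open>This \<open>s\<close> turns the right-hand side of \<open>*\<close> into
      -1.\<close>
    then show False using *[of "- (Q f f + 1) / (2 * Q f g)"] by (simp add: field_simps)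
  qed
  then show ?thesis using True by simp
next
  case False
  then have pos: "0 < Q g g" using nonneg[OF g] by simp
  \<comment> \<open>The vector is \<open>Q g g\<close> times the component of \<open>f\<close>
    orthogonal to \<open>g\<close>; scaling by \<open>Q g g\<close> avoids a division.\<close>
  have "0 \<le> (Q g g)\<^sup>2 * Q f f + 2 * Q g g * (- Q f g) * Q f g + (- Q f g)\<^sup>2 * Q g g"
    using nonneg[OF lin_closed[OF f g, of "Q g g" "- Q f g"]] lin_self[OF f g, of "Q g g" "- Q f g"]
    by simp
  also have "\<dots> = Q g g * (Q f f * Q g g - (Q f g)\<^sup>2)"
    by (simp add: algebra_simps power2_eq_square)
  finally show ?thesis using pos by (simp add: zero_le_mult_iff)
qed

lemma cauchy_schwarz_sqrt:
  assumes "f \<in> S" "g \<in> S"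
  shows "\<bar>Q f g\<bar> \<le> sqrt (Q f f) * sqrt (Q g g)"
  using real_sqrt_le_mono[OF cauchy_schwarz[OF assms]] by (simp add: real_sqrt_mult)

lemma triangle_diff:
  assumes f: "f \<in> S" and g: "g \<in> S"
  shows "sqrt (Q g g) \<le> sqrt (Q f f) + sqrt (Q (\<lambda>x. f x - g x) (\<lambda>x. f x - g x))"
proof -
  define d where "d = (\<lambda>x. f x - g x)"
  have d: "d \<in> S" unfolding d_def by (rule diff_closed[OF f g])
  have nn: "0 \<le> Q f f" "0 \<le> Q d d" using nonneg f d by auto
  have g_eq: "g = (\<lambda>x. f x - d x)" by (auto simp: d_def)
  have "Q g g = Q f f - 2 * Q f d + Q d d"
    by (subst (1 2) g_eq) (rule diff_self[OF f d])
  also have "\<dots> \<le> Q f f + 2 * (sqrt (Q f f) * sqrt (Q d d)) + Q d d"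
    using cauchy_schwarz_sqrt[OF f d] by linarith
  also have "\<dots> = (sqrt (Q f f) + sqrt (Q d d))\<^sup>2"
    using nn by (simp add: power2_sum)
  finally show ?thesis
    unfolding d_def[symmetric] by (intro real_le_lsqrt) (use nn in auto)
qed

lemma triangle_diff':
  assumes f: "f \<in> S" and g: "g \<in> S"
  shows "sqrt (Q f f) \<le> sqrt (Q g g) + sqrt (Q (\<lambda>x. f x - g x) (\<lambda>x. f x - g x))"
  using triangle_diff[OF g f] sym[OF f g] by (simp add: diff_self f g algebra_simps)

text \<open>Convergence is measured in the seminorm of \<open>Q\<close> itself, so energy limits and
  L2 limits are both covered.\<close>

lemma tendsto_left:
  assumes u: "\<And>n. u n \<in> S" and v: "v \<in> S" and w: "w \<in> S"
    and lim: "(\<lambda>n. Q (\<lambda>x. u n x - v x) (\<lambda>x. u n x - v x)) \<longlonglongrightarrow> 0"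
  shows "(\<lambda>n. Q (u n) w) \<longlonglongrightarrow> Q v w"
proof -
  have "(\<lambda>n. sqrt (Q (\<lambda>x. u n x - v x) (\<lambda>x. u n x - v x)) * sqrt (Q w w)) \<longlonglongrightarrow> sqrt 0 * sqrt (Q w w)"
    by (intro tendsto_intros lim)
  moreover have "norm (Q (u n) w - Q v w) \<le> sqrt (Q (\<lambda>x. u n x - v x) (\<lambda>x. u n x - v x)) * sqrt (Q w w)" for n
    using cauchy_schwarz_sqrt[OF diff_closed[OF u[of n] v] w] diff_left[OF u[of n] v w]
    by (simp only: real_norm_def)
  ultimately have "(\<lambda>n. Q (u n) w - Q v w) \<longlonglongrightarrow> 0"
    using Lim_null_comparison[where f = "\<lambda>n. Q (u n) w - Q v w" and net = sequentially
      and g = "\<lambda>n. sqrt (Q (\<lambda>x. u n x - v x) (\<lambda>x. u n x - v x)) * sqrt (Q w w)"]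
    by simp
  then show ?thesis by (simp add: LIM_zero_iff)
qed

end

section \<open>The space of square integrable functions\<close>

lemma abs_powr_two [simp]: "\<bar>x::real\<bar> powr 2 = x\<^sup>2"
  by (cases "x = 0") (simp_all add: powr_numeral)

lemma Lp_2_iff: "f \<in> Lp M 2 \<longleftrightarrow> f \<in> borel_measurable M \<and> integrable M (\<lambda>x. (f x)\<^sup>2)"
  by (simp add: Lp_def)

lemma Lp_1_iff: "f \<in> Lp M 1 \<longleftrightarrow> integrable M f"
  by (auto simp: Lp_def integrable_abs_iff)

lemma Lp_2_mult_integrable:
  assumes "f \<in> Lp M 2" "g \<in> Lp M 2"
  shows "integrable M (\<lambda>x. f x * g x)"
proof (rule Bochner_Integration.integrable_bound)
  show "integrable M (\<lambda>x. (f x)\<^sup>2 + (g x)\<^sup>2)"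
    using assms by (simp add: Lp_2_iff)
  show "(\<lambda>x. f x * g x) \<in> borel_measurable M"
    using assms by (auto simp: Lp_2_iff)
  have "\<bar>a * b\<bar> \<le> a\<^sup>2 + b\<^sup>2" for a b :: real
  proof -
    have "0 \<le> a\<^sup>2" "0 \<le> b\<^sup>2" by simp_all
    moreover have "2 * (\<bar>a\<bar> * \<bar>b\<bar>) \<le> a\<^sup>2 + b\<^sup>2"
      using sum_squares_bound[of "\<bar>a\<bar>" "\<bar>b\<bar>"] by simp
    ultimately show ?thesis unfolding abs_mult by linarith
  qed
  then show "AE x in M. norm (f x * g x) \<le> norm ((f x)\<^sup>2 + (g x)\<^sup>2)"
    by simp
qed

lemma Lp_2_lin:
  assumes f: "f \<in> Lp M 2" and g: "g \<in> Lp M 2"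
  shows "(\<lambda>x. a * f x + b * g x) \<in> Lp M 2"
proof -
  have "integrable M (\<lambda>x. a\<^sup>2 * (f x)\<^sup>2 + 2 * a * b * (f x * g x) + b\<^sup>2 * (g x)\<^sup>2)"
    using Lp_2_mult_integrable[OF f g] f g by (auto simp: Lp_2_iff)
  then have "integrable M (\<lambda>x. (a * f x + b * g x)\<^sup>2)"
    by (rule back_subst[of "integrable M"]) (auto simp: power2_eq_square algebra_simps)
  then show ?thesis using f g by (auto simp: Lp_2_iff)
qed

definition ip :: "'a measure \<Rightarrow> ('a \<Rightarrow> real) \<Rightarrow> ('a \<Rightarrow> real) \<Rightarrow> real" where
  "ip M f g = (\<integral>x. f x * g x \<partial>M)"

lemma semi_inner_ip: "semi_inner (Lp M 2) (ip M)"
proof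
  fix f g h :: "'a \<Rightarrow> real" and a b :: real
  assume f: "f \<in> Lp M 2" and g: "g \<in> Lp M 2"
  show "(\<lambda>x. a * f x + b * g x) \<in> Lp M 2" by (rule Lp_2_lin[OF f g])
  show "ip M f g = ip M g f" by (simp add: ip_def mult.commute)
  assume h: "h \<in> Lp M 2"
  have "ip M (\<lambda>x. a * f x + b * g x) h = (\<integral>x. a * (f x * h x) + b * (g x * h x) \<partial>M)"
    by (simp add: ip_def algebra_simps)
  also have "\<dots> = a * ip M f h + b * ip M g h"
    using Lp_2_mult_integrable[OF f h] Lp_2_mult_integrable[OF g h] by (simp add: ip_def)
  finally show "ip M (\<lambda>x. a * f x + b * g x) h = a * ip M f h + b * ip M g h" .
qed (auto simp: ip_def)

lemma ip_self: "ip M f f = (\<integral>x. (f x)\<^sup>2 \<partial>M)"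
  by (simp add: ip_def power2_eq_square)

lemma Lp_norm_2_eq: "Lp_norm M 2 f = sqrt (ip M f f)"
  by (simp add: Lp_norm_def ip_self powr_half_sqrt)

lemma Lp_norm_2_sq: "(Lp_norm M 2 f)\<^sup>2 = ip M f f"
  by (simp add: Lp_norm_2_eq ip_self)

lemma ip_self_eq_0_iff:
  assumes "f \<in> Lp M 2"
  shows "ip M f f = 0 \<longleftrightarrow> (AE x in M. f x = 0)"
  using assms by (simp add: ip_self Lp_2_iff integral_nonneg_eq_0_iff_AE)

lemma ip_cong_AE:
  assumes "f \<in> borel_measurable M" "g \<in> borel_measurable M" "h \<in> borel_measurable M"
    and "AE x in M. f x = g x"
  shows "ip M f h = ip M g h"
  unfolding ip_def using assms by (intro integral_cong_AE) auto

section \<open>Resolvents and the approximating forms\<close>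

context dirichlet_space
begin

sublocale L2: semi_inner "Lp M 2" "ip M"
  by (rule semi_inner_ip)

sublocale form: semi_inner F E
  by unfold_locales (auto intro: dom_lin form_lin form_sym form_nonneg)

lemma dom_L2D: "f \<in> F \<Longrightarrow> f \<in> Lp M 2"
  using dom_L2 by blast

lemma energy_norm_sq:
  assumes "f \<in> F"
  shows "(energy_norm M E f)\<^sup>2 = ip M f f + E f f"
  using assms L2.nonneg[of f] form_nonneg[of f]
  by (simp add: energy_norm_def Lp_norm_2_sq dom_L2D)

lemma energy_norm_tendsto_0D:
  assumes "\<And>n. u n \<in> F" "v \<in> F" and lim: "(\<lambda>n. energy_norm M E (\<lambda>x. u n x - v x)) \<longlonglongrightarrow> 0"
  shows "(\<lambda>n. ip M (\<lambda>x. u n x - v x) (\<lambda>x. u n x - v x)) \<longlonglongrightarrow> 0"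
    and "(\<lambda>n. E (\<lambda>x. u n x - v x) (\<lambda>x. u n x - v x)) \<longlonglongrightarrow> 0"
proof -
  have d: "(\<lambda>x. u n x - v x) \<in> F" for n
    using assms form.diff_closed by blast
  have "(\<lambda>n. (energy_norm M E (\<lambda>x. u n x - v x))\<^sup>2) \<longlonglongrightarrow> 0\<^sup>2"
    by (intro tendsto_intros lim)
  then have *: "(\<lambda>n. ip M (\<lambda>x. u n x - v x) (\<lambda>x. u n x - v x) + E (\<lambda>x. u n x - v x) (\<lambda>x. u n x - v x)) \<longlonglongrightarrow> 0"
    by (simp add: energy_norm_sq d)
  show "(\<lambda>n. ip M (\<lambda>x. u n x - v x) (\<lambda>x. u n x - v x)) \<longlonglongrightarrow> 0"
    using form_nonneg[OF d] L2.nonneg[OF dom_L2D[OF d]]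
    by (intro tendsto_sandwich[OF _ _ tendsto_const *]) auto
  show "(\<lambda>n. E (\<lambda>x. u n x - v x) (\<lambda>x. u n x - v x)) \<longlonglongrightarrow> 0"
    using form_nonneg[OF d] L2.nonneg[OF dom_L2D[OF d]]
    by (intro tendsto_sandwich[OF _ _ tendsto_const *]) auto
qed

text \<open>Closedness in terms of squared norms, which is what the parallelogram identity delivers.
  The conclusion is split so that each part can be used with its own semi-inner product.\<close>

lemma complete:
  assumes u: "\<And>n. u n \<in> F"
    and cauchy: "\<And>e. 0 < e \<Longrightarrow> \<exists>N. \<forall>m\<ge>N. \<forall>n\<ge>N.
        ip M (\<lambda>x. u m x - u n x) (\<lambda>x. u m x - u n x) + E (\<lambda>x. u m x - u n x) (\<lambda>x. u m x - u n x) < e"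
  obtains v where "v \<in> F"
    "(\<lambda>n. ip M (\<lambda>x. u n x - v x) (\<lambda>x. u n x - v x)) \<longlonglongrightarrow> 0"
    "(\<lambda>n. E (\<lambda>x. u n x - v x) (\<lambda>x. u n x - v x)) \<longlonglongrightarrow> 0"
proof -
  have "\<exists>N. \<forall>m\<ge>N. \<forall>n\<ge>N. energy_norm M E (\<lambda>x. u m x - u n x) < e" if "0 < e" for e
  proof -
    obtain N where N: "\<forall>m\<ge>N. \<forall>n\<ge>N. (energy_norm M E (\<lambda>x. u m x - u n x))\<^sup>2 < e\<^sup>2"
      using cauchy[of "e\<^sup>2"] \<open>0 < e\<close> by (auto simp: energy_norm_sq form.diff_closed u)
    then have "\<forall>m\<ge>N. \<forall>n\<ge>N. energy_norm M E (\<lambda>x. u m x - u n x) < e"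
      using power2_less_imp_less[of _ e] \<open>0 < e\<close> by auto
    then show ?thesis ..
  qed
  then obtain v where v: "v \<in> F" "(\<lambda>n. energy_norm M E (\<lambda>x. u n x - v x)) \<longlonglongrightarrow> 0"
    using closed[of u] u by blast
  then show ?thesis
    using energy_norm_tendsto_0D[OF u v] that by blast
qed

text \<open>In terms of the resolvent \<open>G\<^sub>\<lambda>\<close> of the form, \<open>u\<close> is \<open>\<lambda> G\<^sub>\<lambda> h\<close>. It is obtained as the minimiser
  of \<open>E(v,v) + \<lambda> \<parallel>h - v\<parallel>\<^sup>2\<close>: minimising sequences are Cauchy by the parallelogram law.\<close>

lemma resolvent_exists:
  assumes h: "h \<in> Lp M 2" and l: "0 < l"
  shows "\<exists>u\<in>F. \<forall>w\<in>F. E u w = l * ip M (\<lambda>x. h x - u x) w"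
proof -
  define J where "J v = E v v + l * ip M (\<lambda>x. h x - v x) (\<lambda>x. h x - v x)" for v
  define I where "I = Inf (J ` F)"
  have hv: "(\<lambda>x. h x - v x) \<in> Lp M 2" if "v \<in> F" for v
    using L2.diff_closed[OF h dom_L2D[OF that]] .
  have J0: "0 \<le> J v" if "v \<in> F" for v
    using form_nonneg[OF that] L2.nonneg[OF hv[OF that]] l by (simp add: J_def)
  then have bdd: "bdd_below (J ` F)" by (intro bdd_belowI2[of _ 0]) auto
  have I: "I \<le> J v" if "v \<in> F" for v
    unfolding I_def using bdd that by (intro cInf_lower) auto
  have "\<exists>v\<in>F. J v < I + 1 / real (Suc n)" for n
  proof -
    have "Inf (J ` F) < I + 1 / real (Suc n)" by (simp add: I_def)
    then show ?thesis using bdd dom_zero by (subst (asm) cInf_less_iff) auto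
  qed
  then obtain v where v: "\<And>n. v n \<in> F" and vI: "\<And>n. J (v n) < I + 1 / real (Suc n)"
    by metis
  have par: "E (\<lambda>x. a x - b x) (\<lambda>x. a x - b x) + l * ip M (\<lambda>x. a x - b x) (\<lambda>x. a x - b x)
      \<le> 2 * (J a - I) + 2 * (J b - I)" if a: "a \<in> F" and b: "b \<in> F" for a b
  proof -
    define m where "m = (\<lambda>x. 1/2 * a x + 1/2 * b x)"
    have m: "m \<in> F" unfolding m_def by (rule dom_lin[OF a b])
    have "(\<lambda>x. h x - m x) = (\<lambda>x. 1/2 * (h x - a x) + 1/2 * (h x - b x))"
      by (auto simp: m_def field_simps)
    then have 1: "ip M (\<lambda>x. h x - m x) (\<lambda>x. h x - m x) = 1/4 * ip M (\<lambda>x. h x - a x) (\<lambda>x. h x - a x)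
        + 1/2 * ip M (\<lambda>x. h x - a x) (\<lambda>x. h x - b x) + 1/4 * ip M (\<lambda>x. h x - b x) (\<lambda>x. h x - b x)"
      using L2.lin_self[OF hv[OF a] hv[OF b], of "1/2" "1/2"] by (simp add: power2_eq_square)
    have "ip M (\<lambda>x. (h x - b x) - (h x - a x)) (\<lambda>x. (h x - b x) - (h x - a x))
       = ip M (\<lambda>x. h x - b x) (\<lambda>x. h x - b x) - 2 * ip M (\<lambda>x. h x - b x) (\<lambda>x. h x - a x)
         + ip M (\<lambda>x. h x - a x) (\<lambda>x. h x - a x)"
      by (rule L2.diff_self[OF hv[OF b] hv[OF a]])
    then have 2: "ip M (\<lambda>x. a x - b x) (\<lambda>x. a x - b x)
       = ip M (\<lambda>x. h x - b x) (\<lambda>x. h x - b x) - 2 * ip M (\<lambda>x. h x - a x) (\<lambda>x. h x - b x)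
         + ip M (\<lambda>x. h x - a x) (\<lambda>x. h x - a x)"
      using L2.sym[OF hv[OF a] hv[OF b]] by simp
    have 3: "E m m = 1/4 * E a a + 1/2 * E a b + 1/4 * E b b"
      unfolding m_def using form.lin_self[OF a b, of "1/2" "1/2"] by (simp add: power2_eq_square)
    have 4: "E (\<lambda>x. a x - b x) (\<lambda>x. a x - b x) = E a a - 2 * E a b + E b b"
      by (rule form.diff_self[OF a b])
    have "E (\<lambda>x. a x - b x) (\<lambda>x. a x - b x) + l * ip M (\<lambda>x. a x - b x) (\<lambda>x. a x - b x)
        = 2 * J a + 2 * J b - 4 * J m"
      unfolding J_def 1 2 3 4 by (simp add: algebra_simps)
    then show ?thesis using I[OF m] by simp
  qed
  obtain u where u: "u \<in> F"
    and lim2: "(\<lambda>n. ip M (\<lambda>x. v n x - u x) (\<lambda>x. v n x - u x)) \<longlonglongrightarrow> 0"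
    and limE: "(\<lambda>n. E (\<lambda>x. v n x - u x) (\<lambda>x. v n x - u x)) \<longlonglongrightarrow> 0"
  proof (rule complete[of v])
    fix e :: real assume "0 < e"
    \<comment> \<open>The parallelogram bound controls \<open>?B + l * ?A\<close>; passing to
      \<open>?A + ?B\<close> costs the factor \<open>c\<close>, since \<open>?A\<close> is at most
      \<open>1 / l\<close> times and \<open>?B\<close> at most once that quantity.\<close>
    define c where "c = 1 + 1 / l"
    have c: "0 < c" using l by (simp add: c_def add_pos_pos)
    obtain N where N: "1 / real (Suc N) < e / (4 * c)"
      using nat_approx_posE[of "e / (4 * c)"] \<open>0 < e\<close> c by auto
    show "\<exists>N. \<forall>m\<ge>N. \<forall>n\<ge>N. ip M (\<lambda>x. v m x - v n x) (\<lambda>x. v m x - v n x)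
            + E (\<lambda>x. v m x - v n x) (\<lambda>x. v m x - v n x) < e"
    proof (intro exI[of _ N] allI impI)
      fix m n assume mn: "N \<le> m" "N \<le> n"
      let ?A = "ip M (\<lambda>x. v m x - v n x) (\<lambda>x. v m x - v n x)"
      let ?B = "E (\<lambda>x. v m x - v n x) (\<lambda>x. v m x - v n x)"
      have A: "0 \<le> ?A" using L2.nonneg[OF dom_L2D[OF form.diff_closed[OF v v]]] .
      have B: "0 \<le> ?B" using form_nonneg[OF form.diff_closed[OF v v]] .
      have "1 / real (Suc k) \<le> 1 / real (Suc N)" if "N \<le> k" for k
        using that by (intro divide_left_mono) auto
      then have near: "J (v k) - I < e / (4 * c)" if "N \<le> k" for k
        using vI[of k] N that by (smt (verit))
      have "?B + l * ?A < 4 * (e / (4 * c))"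
        using par[OF v v, of m n] near[OF mn(1)] near[OF mn(2)] by argo
      then have D: "?B + l * ?A < e / c" by simp
      have "?A \<le> (?B + l * ?A) / l" using B l by (simp add: field_simps)
      moreover have "?B \<le> ?B + l * ?A" using A l by simp
      moreover have "c * y = y + y / l" for y by (simp add: c_def distrib_right)
      ultimately have "?A + ?B \<le> c * (?B + l * ?A)" by (simp only:)
      also have "\<dots> < e" using D c by (simp add: field_simps)
      finally show "?A + ?B < e" .
    qed
  qed (use v in auto)
  have "E u w = l * ip M (\<lambda>x. h x - u x) w" if w: "w \<in> F" for w
  proof -
    define D where "D = E w w + l * ip M w w"
    define B where "B n = E (v n) w - l * ip M (\<lambda>x. h x - v n x) w" for n
    define B0 where "B0 = E u w - l * ip M (\<lambda>x. h x - u x) w"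
    have w2: "w \<in> Lp M 2" using dom_L2D[OF w] .
    have D0: "0 \<le> D" using form_nonneg[OF w] L2.nonneg[OF w2] l by (simp add: D_def)
    \<comment> \<open>Moving from \<open>v n\<close> in the direction \<open>w\<close> cannot bring
      \<open>J\<close> below \<open>I\<close>, and \<open>2 * B n\<close> is the derivative of
      \<open>J\<close> in that direction. In the limit this becomes the Euler-Lagrange equation
      \<open>B0 = 0\<close>.\<close>
    have ineq: "- (1 / real (Suc n)) \<le> 2 * s * B n + s\<^sup>2 * D" for n s
    proof -
      have z: "(\<lambda>x. 1 * v n x + s * w x) \<in> F" by (rule dom_lin[OF v w])
      have e: "(\<lambda>x. h x - (1 * v n x + s * w x)) = (\<lambda>x. 1 * (h x - v n x) + (- s) * w x)"
        by (auto simp: algebra_simps)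
      have "J (\<lambda>x. 1 * v n x + s * w x) = J (v n) + 2 * s * B n + s\<^sup>2 * D"
        unfolding J_def e B_def D_def form.lin_self[OF v w] L2.lin_self[OF hv[OF v] w2]
        by (simp add: algebra_simps)
      then show ?thesis using I[OF z] vI[of n] by simp
    qed
    have "(\<lambda>n. E (v n) w) \<longlonglongrightarrow> E u w"
      by (rule form.tendsto_left[OF v u w limE])
    moreover have "(\<lambda>n. ip M (v n) w) \<longlonglongrightarrow> ip M u w"
      by (rule L2.tendsto_left[OF dom_L2D[OF v] dom_L2D[OF u] w2 lim2])
    ultimately have "(\<lambda>n. E (v n) w - l * (ip M h w - ip M (v n) w)) \<longlonglongrightarrow> E u w - l * (ip M h w - ip M u w)"
      by (intro tendsto_intros)
    then have limB: "B \<longlonglongrightarrow> B0"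
      unfolding B_def B0_def by (simp add: L2.diff_left h dom_L2D u v w2)
    have q: "0 \<le> 2 * s * B0 + s\<^sup>2 * D" for s
    proof -
      have "(\<lambda>n. 2 * s * B n + s\<^sup>2 * D) \<longlonglongrightarrow> 2 * s * B0 + s\<^sup>2 * D"
        by (intro tendsto_intros limB)
      moreover have "(\<lambda>n. - (1 / real (Suc n))) \<longlonglongrightarrow> - 0"
        by (intro tendsto_minus LIMSEQ_Suc lim_1_over_n)
      ultimately show ?thesis
        using ineq by (intro LIMSEQ_le[of "\<lambda>n. - (1 / real (Suc n))" 0]) auto
    qed
    have "B0 = 0"
    proof (rule ccontr)
      assume ne: "B0 \<noteq> 0"
      \<comment> \<open>The added 1 covers the case \<open>D = 0\<close> and still leaves
        \<open>t * D - 2\<close> negative.\<close>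
      define t where "t = 1 / (D + 1)"
      have t: "0 < t" "t * D \<le> 1" using D0 by (simp_all add: t_def)
      have "2 * (- B0 * t) * B0 + (- B0 * t)\<^sup>2 * D = B0\<^sup>2 * (t * (t * D - 2))"
        by (simp add: algebra_simps power2_eq_square)
      also have "\<dots> < 0" using ne t by (intro mult_pos_neg) auto
      finally show False using q[of "- B0 * t"] by simp
    qed
    then show ?thesis by (simp add: B0_def)
  qed
  then show ?thesis using u by blast
qed

text \<open>If \<open>u\<^sub>i = \<lambda>\<^sub>i G\<^sub>\<lambda>\<^sub>i h\<close> with \<open>\<lambda>\<^sub>1 < \<lambda>\<^sub>2\<close>, then \<open>E(u\<^sub>1, u\<^sub>2 - u\<^sub>1) \<ge> 0\<close>; so the energy
  increases with \<open>\<lambda>\<close> and controls the Cauchy property.\<close>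

lemma resolvent_energy_diff:
  assumes h: "h \<in> Lp M 2" and l: "0 < l" "l < k" and u: "u \<in> F" "v \<in> F"
    and ru: "\<And>w. w \<in> F \<Longrightarrow> E u w = l * ip M (\<lambda>x. h x - u x) w"
    and rv: "\<And>w. w \<in> F \<Longrightarrow> E v w = k * ip M (\<lambda>x. h x - v x) w"
  shows "E (\<lambda>x. v x - u x) (\<lambda>x. v x - u x) \<le> E v v - E u u"
proof -
  define w where "w = (\<lambda>x. v x - u x)"
  have w: "w \<in> F" unfolding w_def using form.diff_closed u by blast
  have w2: "w \<in> Lp M 2" using dom_L2D[OF w] .
  have u2: "u \<in> Lp M 2" "v \<in> Lp M 2" using dom_L2D u by auto
  define \<alpha> where "\<alpha> = ip M (\<lambda>x. h x - u x) w"
  have "(\<lambda>x. h x - v x) = (\<lambda>x. (h x - u x) - w x)" by (auto simp: w_def)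
  then have b: "ip M (\<lambda>x. h x - v x) w = \<alpha> - ip M w w"
    by (simp add: \<alpha>_def L2.diff_left[OF L2.diff_closed[OF h u2(1)] w2 w2])
  have "E w w = E v w - E u w"
    by (subst (1) w_def) (rule form.diff_left[OF u(2,1) w])
  also have "\<dots> = k * (\<alpha> - ip M w w) - l * \<alpha>" using rv[OF w] ru[OF w] b by (simp add: \<alpha>_def)
  finally have "0 \<le> k * (\<alpha> - ip M w w) - l * \<alpha>" using form_nonneg[OF w] by simp
  then have "k * ip M w w \<le> (k - l) * \<alpha>" by (simp add: algebra_simps)
  moreover have "0 \<le> k * ip M w w" using l L2.nonneg[OF w2] by simp
  ultimately have "0 \<le> \<alpha>" using l by (smt (verit) mult_pos_neg)
  then have 1: "0 \<le> E u w" using ru[OF w] l by (simp add: \<alpha>_def)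
  have "E u w = E u v - E u u"
    unfolding w_def using form.diff_right[OF u(2,1,1)] by simp
  then show ?thesis using 1 form.diff_self[OF u(2,1)] form_sym[OF u] by simp
qed

text \<open>The second bound gives L2 convergence to \<open>h\<close> at rate
  \<open>C / (n + 1)\<close>. The energies increase and stay below \<open>C\<close>, so they
  converge, and \<open>resolvent_energy_diff\<close> turns this into the Cauchy property in energy.
  Used twice: with a bound from the semigroup to place \<open>h\<close> in \<open>F\<close>, and
  with \<open>C = E h h\<close> to approximate a given element of \<open>F\<close>.\<close>

lemma resolvent_approx:
  assumes h: "h \<in> Lp M 2" and u: "\<And>n. u n \<in> F"
    and r: "\<And>n w. w \<in> F \<Longrightarrow> E (u n) w = real (Suc n) * ip M (\<lambda>x. h x - u n x) w"
    and bdE: "\<And>n. E (u n) (u n) \<le> C"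
    and bd2: "\<And>n. real (Suc n) * ip M (\<lambda>x. h x - u n x) (\<lambda>x. h x - u n x) \<le> C"
  shows "h \<in> F" and "(\<lambda>n. ip M (\<lambda>x. u n x - h x) (\<lambda>x. u n x - h x)) \<longlonglongrightarrow> 0"
    and "(\<lambda>n. E (\<lambda>x. u n x - h x) (\<lambda>x. u n x - h x)) \<longlonglongrightarrow> 0"
proof -
  have u2: "u n \<in> Lp M 2" for n using dom_L2D[OF u] .
  have swap: "ip M (\<lambda>x. a x - b x) (\<lambda>x. a x - b x) = ip M (\<lambda>x. b x - a x) (\<lambda>x. b x - a x)" for a b
    by (simp add: ip_self power2_commute)
  have "(\<lambda>n. C / real (Suc n)) \<longlonglongrightarrow> 0"
    by (intro LIMSEQ_Suc lim_const_over_n)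
  then show L2: "(\<lambda>n. ip M (\<lambda>x. u n x - h x) (\<lambda>x. u n x - h x)) \<longlonglongrightarrow> 0"
  proof (rule tendsto_sandwich[OF _ _ tendsto_const, rotated 2])
    show "\<forall>\<^sub>F n in sequentially. 0 \<le> ip M (\<lambda>x. u n x - h x) (\<lambda>x. u n x - h x)"
      by (simp add: L2.nonneg L2.diff_closed h u2)
    have "ip M (\<lambda>x. u n x - h x) (\<lambda>x. u n x - h x) \<le> C / real (Suc n)" for n
      using bd2[of n] swap[of "u n" h] by (simp add: pos_le_divide_eq mult.commute del: of_nat_Suc)
    then show "\<forall>\<^sub>F n in sequentially. ip M (\<lambda>x. u n x - h x) (\<lambda>x. u n x - h x) \<le> C / real (Suc n)"
      by simp
  qed
  have inc: "E (\<lambda>x. u n x - u m x) (\<lambda>x. u n x - u m x) \<le> E (u n) (u n) - E (u m) (u m)" if "m \<le> n" for m n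
  proof (cases "m = n")
    case True
    then show ?thesis using form.diff_self[OF u u, of n n] by simp
  next
    case False
    then show ?thesis
      using that resolvent_energy_diff[OF h _ _ u u r r, of m n] by auto
  qed
  have "incseq (\<lambda>n. E (u n) (u n))"
    using order_trans[OF form_nonneg[OF form.diff_closed[OF u u]] inc] by (auto simp: incseq_def)
  then obtain L where L: "(\<lambda>n. E (u n) (u n)) \<longlonglongrightarrow> L" "\<And>n. E (u n) (u n) \<le> L"
    using incseq_convergent[of "\<lambda>n. E (u n) (u n)" C] bdE by blast
  have swapE: "E (\<lambda>x. u m x - u n x) (\<lambda>x. u m x - u n x) = E (\<lambda>x. u n x - u m x) (\<lambda>x. u n x - u m x)" for m n
    using form_sym[OF u u, of n m] by (simp add: form.diff_self[OF u u])
  obtain v where v: "v \<in> F"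
    and lim2: "(\<lambda>n. ip M (\<lambda>x. u n x - v x) (\<lambda>x. u n x - v x)) \<longlonglongrightarrow> 0"
    and limE: "(\<lambda>n. E (\<lambda>x. u n x - v x) (\<lambda>x. u n x - v x)) \<longlonglongrightarrow> 0"
  proof (rule complete[of u])
    fix e :: real assume e: "0 < e"
    obtain N1 where N1: "\<And>n. N1 \<le> n \<Longrightarrow> ip M (\<lambda>x. u n x - h x) (\<lambda>x. u n x - h x) < e / 8"
      using order_tendstoD(2)[OF L2, of "e/8"] e by (auto simp: eventually_sequentially)
    obtain N2 where N2: "\<And>n. N2 \<le> n \<Longrightarrow> L - e / 2 < E (u n) (u n)"
      using order_tendstoD(1)[OF L(1), of "L - e / 2"] e by (auto simp: eventually_sequentially)
    show "\<exists>N. \<forall>m\<ge>N. \<forall>n\<ge>N. ip M (\<lambda>x. u m x - u n x) (\<lambda>x. u m x - u n x)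
            + E (\<lambda>x. u m x - u n x) (\<lambda>x. u m x - u n x) < e"
    proof (intro exI[of _ "max N1 N2"] allI impI)
      fix m n assume mn: "max N1 N2 \<le> m" "max N1 N2 \<le> n"
      have a: "(\<lambda>x. u k x - h x) \<in> Lp M 2" for k by (rule L2.diff_closed[OF u2 h])
      have "0 \<le> ip M (\<lambda>x. 1 * (u m x - h x) + 1 * (u n x - h x)) (\<lambda>x. 1 * (u m x - h x) + 1 * (u n x - h x))"
        by (rule L2.nonneg[OF L2.lin_closed[OF a a]])
      then have "ip M (\<lambda>x. (u m x - h x) - (u n x - h x)) (\<lambda>x. (u m x - h x) - (u n x - h x))
          \<le> 2 * ip M (\<lambda>x. u m x - h x) (\<lambda>x. u m x - h x) + 2 * ip M (\<lambda>x. u n x - h x) (\<lambda>x. u n x - h x)"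
        unfolding L2.lin_self[OF a a] L2.diff_self[OF a a] by simp
      then have "ip M (\<lambda>x. u m x - u n x) (\<lambda>x. u m x - u n x) < e / 2"
        using N1[of m] N1[of n] mn by simp
      moreover have "E (\<lambda>x. u m x - u n x) (\<lambda>x. u m x - u n x) < e / 2"
        using inc[of m n] inc[of n m] swapE[of m n] N2[of m] N2[of n] L(2)[of m] L(2)[of n] mn
        by (cases "m \<le> n") auto
      ultimately show "ip M (\<lambda>x. u m x - u n x) (\<lambda>x. u m x - u n x)
            + E (\<lambda>x. u m x - u n x) (\<lambda>x. u m x - u n x) < e" by simp
    qed
  qed (use u in auto)
  have hv: "(\<lambda>x. h x - v x) \<in> Lp M 2" using L2.diff_closed[OF h dom_L2D[OF v]] .
  \<comment> \<open>Testing both L2 limits of the same sequence against their difference shows that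
    \<open>h\<close> and \<open>v\<close> agree almost everywhere; \<open>form_cong\<close> then
    replaces \<open>v\<close> by \<open>h\<close> inside the form.\<close>
  have "(\<lambda>n. ip M (u n) (\<lambda>x. h x - v x)) \<longlonglongrightarrow> ip M h (\<lambda>x. h x - v x)"
    by (rule L2.tendsto_left[OF u2 h hv L2])
  moreover have "(\<lambda>n. ip M (u n) (\<lambda>x. h x - v x)) \<longlonglongrightarrow> ip M v (\<lambda>x. h x - v x)"
    by (rule L2.tendsto_left[OF u2 dom_L2D[OF v] hv lim2])
  ultimately have "ip M h (\<lambda>x. h x - v x) = ip M v (\<lambda>x. h x - v x)"
    by (rule LIMSEQ_unique)
  then have "ip M (\<lambda>x. h x - v x) (\<lambda>x. h x - v x) = 0"
    by (simp add: L2.diff_left h dom_L2D[OF v] hv)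
  then have ae: "AE x in M. v x = h x"
    using ip_self_eq_0_iff[OF hv] by auto
  show hF: "h \<in> F"
    using dom_cong[OF v _ ae] h by (simp add: Lp_2_iff)
  have Eh: "E w h = E w v" if "w \<in> F" for w
    using form_cong[OF v hF that ae] form_sym[OF v that] form_sym[OF hF that] by simp
  have "E h h = E v v"
    using Eh[OF hF] Eh[OF v] form_sym[OF v hF] by simp
  then have "E (\<lambda>x. u n x - h x) (\<lambda>x. u n x - h x) = E (\<lambda>x. u n x - v x) (\<lambda>x. u n x - v x)" for n
    using form.diff_self[OF u[of n] v] form.diff_self[OF u[of n] hF] Eh[OF u[of n]] by simp
  with limE show "(\<lambda>n. E (\<lambda>x. u n x - h x) (\<lambda>x. u n x - h x)) \<longlonglongrightarrow> 0"
    by simp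
qed

lemma resolvent_seq_exists:
  assumes "h \<in> Lp M 2"
  obtains u where "\<And>n. u n \<in> F"
    "\<And>n w. w \<in> F \<Longrightarrow> E (u n) w = real (Suc n) * ip M (\<lambda>x. h x - u n x) w"
proof -
  have "\<forall>n. \<exists>u. u \<in> F \<and> (\<forall>w\<in>F. E u w = real (Suc n) * ip M (\<lambda>x. h x - u x) w)"
    using resolvent_exists[OF assms, of "real (Suc _)"] by auto
  then show ?thesis using that by (auto dest!: choice)
qed

end

section \<open>Approximating forms of the heat semigroup\<close>

context heat_semigroup
begin

lemma Lp_in_lebesgue_spaces: "1 \<le> p \<Longrightarrow> Lp M p \<in> lebesgue_spaces M"
  by (simp add: lebesgue_spaces_def)

lemma P_L2: "\<lbrakk>0 \<le> t; f \<in> Lp M 2\<rbrakk> \<Longrightarrow> P t f \<in> Lp M 2"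
  by (rule closed_under[OF _ Lp_in_lebesgue_spaces]) auto

lemma P_lin_left:
  assumes t: "0 \<le> t" and f: "f \<in> Lp M 2" and g: "g \<in> Lp M 2" and h: "h \<in> Lp M 2"
  shows "ip M (P t (\<lambda>x. a * f x + b * g x)) h = a * ip M (P t f) h + b * ip M (P t g) h"
proof -
  note L = P_L2[OF t f] P_L2[OF t g] P_L2[OF t L2.lin_closed[OF f g]]
  have "ip M (P t (\<lambda>x. a * f x + b * g x)) h = ip M (\<lambda>x. a * P t f x + b * P t g x) h"
    using linear[OF t Lp_in_lebesgue_spaces f g, of a b] L L2.lin_closed[OF L(1,2), of a b] h
    by (intro ip_cong_AE) (auto simp: Lp_2_iff)
  also have "\<dots> = a * ip M (P t f) h + b * ip M (P t g) h"
    by (rule L2.lin_left[OF L(1,2) h])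
  finally show ?thesis .
qed

lemma P_sym: "\<lbrakk>0 \<le> t; f \<in> Lp M 2; g \<in> Lp M 2\<rbrakk> \<Longrightarrow> ip M (P t f) g = ip M f (P t g)"
  unfolding ip_def by (rule self_adjoint)

lemma P_contraction:
  assumes "0 \<le> t" "f \<in> Lp M 2"
  shows "ip M (P t f) (P t f) \<le> ip M f f"
  using contraction_Lp[of t 2 f] assms by (simp add: Lp_norm_2_eq)

lemma P_half:
  assumes t: "0 \<le> t" and f: "f \<in> Lp M 2" and g: "g \<in> Lp M 2"
  shows "ip M (P t f) g = ip M (P (t / 2) f) (P (t / 2) g)"
proof -
  have t2: "0 \<le> t / 2" using t by simp
  have "ip M (P (t / 2 + t / 2) f) g = ip M (P (t / 2) (P (t / 2) f)) g"
    using semigroup[OF t2 t2 Lp_in_lebesgue_spaces f] P_L2[OF t2 P_L2[OF t2 f]] P_L2[of "t/2 + t/2" f] t f g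
    by (intro ip_cong_AE) (auto simp: Lp_2_iff)
  then show ?thesis using P_sym[OF t2 P_L2[OF t2 f] g] by simp
qed

definition approx_form :: "real \<Rightarrow> ('a \<Rightarrow> real) \<Rightarrow> ('a \<Rightarrow> real) \<Rightarrow> real" where
  "approx_form t f g = (ip M f g - ip M (P t f) g) / t"

lemma semi_inner_approx_form:
  assumes t: "0 < t"
  shows "semi_inner (Lp M 2) (approx_form t)"
proof
  fix f g h :: "'a \<Rightarrow> real" and a b :: real
  assume f: "f \<in> Lp M 2"
  have "(ip M (P t f) f)\<^sup>2 \<le> ip M (P t f) (P t f) * ip M f f"
    using t by (intro L2.cauchy_schwarz P_L2 f) auto
  also have "\<dots> \<le> (ip M f f)\<^sup>2"
    unfolding power2_eq_square using t by (intro mult_right_mono P_contraction f L2.nonneg) auto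
  finally have "ip M (P t f) f \<le> ip M f f"
    using L2.nonneg[OF f] power2_le_imp_le by blast
  then show "0 \<le> approx_form t f f"
    using t by (simp add: approx_form_def)
  assume g: "g \<in> Lp M 2"
  show "(\<lambda>x. a * f x + b * g x) \<in> Lp M 2" by (rule Lp_2_lin[OF f g])
  show "approx_form t f g = approx_form t g f"
    using P_sym[of t f g] L2.sym[OF f g] L2.sym[OF f P_L2[of t g]] t f g by (simp add: approx_form_def)
  assume h: "h \<in> Lp M 2"
  show "approx_form t (\<lambda>x. a * f x + b * g x) h = a * approx_form t f h + b * approx_form t g h"
    using t f g h by (simp add: approx_form_def L2.lin_left P_lin_left field_simps)
qed

text \<open>Expanding the squared L2 norm of \<open>f - P (t / 2) f\<close> gives midpoint convexity
  of \<open>t \<mapsto> \<langle>P t f, f\<rangle>\<close> between 0 and \<open>t\<close>. This is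
  the only monotonicity in \<open>t\<close> that the proof needs.\<close>

lemma approx_form_half:
  assumes t: "0 < t" and f: "f \<in> Lp M 2"
  shows "approx_form t f f \<le> approx_form (t / 2) f f"
proof -
  have P2: "P (t / 2) f \<in> Lp M 2" using P_L2[of "t/2" f] t f by simp
  have "0 \<le> ip M (\<lambda>x. f x - P (t / 2) f x) (\<lambda>x. f x - P (t / 2) f x)"
    using L2.nonneg[OF L2.diff_closed[OF f P2]] .
  also have "\<dots> = ip M f f - 2 * ip M (P (t / 2) f) f + ip M (P t f) f"
    using L2.diff_self[OF f P2] L2.sym[OF f P2] P_half[of t f f] t f by simp
  finally have "ip M f f - ip M (P t f) f \<le> 2 * (ip M f f - ip M (P (t / 2) f) f)" by simp
  then have "(ip M f f - ip M (P t f) f) / t \<le> 2 * (ip M f f - ip M (P (t / 2) f) f) / t"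
    using t by (intro divide_right_mono) auto
  also have "\<dots> = (ip M f f - ip M (P (t / 2) f) f) / (t / 2)" by simp
  finally show ?thesis by (simp only: approx_form_def)
qed

text \<open>The values do not decrease along \<open>t / 2 ^ n\<close>, and the assumed limit can be
  read off along this sequence.\<close>

lemma approx_form_le_limit:
  assumes t: "0 < t" and f: "f \<in> Lp M 2"
    and lim: "((\<lambda>s. approx_form s f f) \<longlongrightarrow> L) (at_right 0)"
  shows "approx_form t f f \<le> L"
proof (rule LIMSEQ_le_const)
  have "filterlim (\<lambda>n. t / 2 ^ n) (at_right 0) sequentially"
    unfolding filterlim_at
  proof
    show "(\<lambda>n. t / 2 ^ n) \<longlonglongrightarrow> 0"
      using tendsto_mult[OF tendsto_const[of t] LIMSEQ_power_zero[of "1/2::real"]]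
      by (simp add: power_divide)
  qed (use t in auto)
  then show "(\<lambda>n. approx_form (t / 2 ^ n) f f) \<longlonglongrightarrow> L"
    by (rule filterlim_compose[OF lim])
  have "approx_form t f f \<le> approx_form (t / 2 ^ n) f f" for n
  proof (induction n)
    case (Suc n)
    have "approx_form (t / 2 ^ n) f f \<le> approx_form (t / 2 ^ n / 2) f f"
      using t by (intro approx_form_half f) simp
    then show ?case using Suc by (simp add: mult.commute)
  qed simp
  then show "\<exists>N. \<forall>n\<ge>N. approx_form t f f \<le> approx_form (t / 2 ^ n) f f" by blast
qed

text \<open>The resolvent equation says that \<open>u\<close> is in the domain of the generator and
  is mapped to \<open>g = l * (u - h)\<close>, so the difference quotients converge in L2. Hence
  \<open>w\<close> may be any L2 function, in particular an \<open>h\<close> not yet known to lie in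
  \<open>F\<close>.\<close>

lemma approx_form_resolvent_tendsto:
  assumes u: "u \<in> F" and h: "h \<in> Lp M 2" and w: "w \<in> Lp M 2"
    and r: "\<And>v. v \<in> F \<Longrightarrow> E u v = l * ip M (\<lambda>x. h x - u x) v"
  shows "((\<lambda>t. approx_form t u w) \<longlongrightarrow> l * ip M (\<lambda>x. h x - u x) w) (at_right 0)"
proof -
  have u2: "u \<in> Lp M 2" using dom_L2D[OF u] .
  define g where "g = (\<lambda>x. l * u x + (- l) * h x)"
  have g2: "g \<in> Lp M 2" unfolding g_def by (rule L2.lin_closed[OF u2 h])
  have gw: "ip M g v = - (l * ip M (\<lambda>x. h x - u x) v)" if "v \<in> Lp M 2" for v
    unfolding g_def L2.lin_left[OF u2 h that] L2.diff_left[OF h u2 that]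
    by (simp add: algebra_simps)
  define d where "d t = (\<lambda>x. 1 * ((1 / t) * P t u x + (- (1 / t)) * u x) + (- 1) * g x)" for t
  have lim: "((\<lambda>t. Lp_norm M 2 (d t)) \<longlongrightarrow> 0) (at_right 0)"
  proof -
    have "d t = (\<lambda>x. (P t u x - u x) / t - g x)" for t
      by (auto simp: d_def diff_divide_distrib)
    moreover have "\<forall>v\<in>F. E u v = - (\<integral>x. g x * v x \<partial>M)"
      using r gw dom_L2D by (simp add: ip_def)
    ultimately show ?thesis using generator[OF u2 g2] u by simp
  qed
  have ev: "\<forall>\<^sub>F t in at_right 0. norm (approx_form t u w - l * ip M (\<lambda>x. h x - u x) w)
      \<le> Lp_norm M 2 (d t) * sqrt (ip M w w)"
    using eventually_at_right_less[of 0]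
  proof eventually_elim
    case (elim t)
    have Pu: "P t u \<in> Lp M 2" using P_L2 elim u2 by simp
    note q = L2.lin_closed[OF Pu u2, of "1/t" "-(1/t)"]
    have d2: "d t \<in> Lp M 2" unfolding d_def by (rule L2.lin_closed[OF q g2])
    have "ip M (d t) w = 1 * ip M (\<lambda>x. (1 / t) * P t u x + (- (1 / t)) * u x) w + (- 1) * ip M g w"
      unfolding d_def by (rule L2.lin_left[OF q g2 w])
    also have "\<dots> = - (approx_form t u w - l * ip M (\<lambda>x. h x - u x) w)"
      unfolding L2.lin_left[OF Pu u2 w] gw[OF w] approx_form_def
      by (simp add: diff_divide_distrib)
    finally show ?case
      using L2.cauchy_schwarz_sqrt[OF d2 w] by (simp add: Lp_norm_2_eq)
  qed
  have "((\<lambda>t. Lp_norm M 2 (d t) * sqrt (ip M w w)) \<longlongrightarrow> 0 * sqrt (ip M w w)) (at_right 0)"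
    by (intro tendsto_mult lim tendsto_const)
  then have "((\<lambda>t. approx_form t u w - l * ip M (\<lambda>x. h x - u x) w) \<longlongrightarrow> 0) (at_right 0)"
    using Lim_null_comparison[OF ev] by simp
  then show ?thesis by (simp add: LIM_zero_iff)
qed

text \<open>With \<open>X\<close> the energy of the resolvent \<open>u n\<close> and
  \<open>Y\<close> its scaled squared distance to \<open>h\<close>,
  \<open>approx_form t (u n) h\<close> tends to \<open>Y + X\<close>. Cauchy-Schwarz for the
  approximating form bounds its square by \<open>X * C\<close>. Thus
  \<open>(Y + X)\<^sup>2 \<le> X * C\<close>, which bounds \<open>X\<close> and then
  \<open>Y\<close> by \<open>C\<close>.\<close>

lemma dom_if_approx_form_bounded:
  assumes h: "h \<in> Lp M 2" and bd: "\<And>t. \<lbrakk>0 < t; t < 1\<rbrakk> \<Longrightarrow> approx_form t h h \<le> C"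
  shows "h \<in> F"
proof -
  have C: "0 \<le> C"
    using bd[of "1/2"] semi_inner.nonneg[OF semi_inner_approx_form h, of "1/2"] by simp
  obtain u where u: "\<And>n. u n \<in> F"
    and r: "\<And>n w. w \<in> F \<Longrightarrow> E (u n) w = real (Suc n) * ip M (\<lambda>x. h x - u n x) w"
    using resolvent_seq_exists[OF h] by blast
  have *: "E (u n) (u n) \<le> C \<and> real (Suc n) * ip M (\<lambda>x. h x - u n x) (\<lambda>x. h x - u n x) \<le> C" for n
  proof -
    define X where "X = E (u n) (u n)"
    define Y where "Y = real (Suc n) * ip M (\<lambda>x. h x - u n x) (\<lambda>x. h x - u n x)"
    have u2: "u n \<in> Lp M 2" using dom_L2D[OF u] .
    have hu: "(\<lambda>x. h x - u n x) \<in> Lp M 2" using L2.diff_closed[OF h u2] .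
    have X: "0 \<le> X" unfolding X_def by (rule form_nonneg[OF u])
    have Y: "0 \<le> Y" unfolding Y_def using L2.nonneg[OF hu] by simp
    have YX: "real (Suc n) * ip M (\<lambda>x. h x - u n x) h = Y + X"
      unfolding X_def Y_def r[OF u] L2.diff_right[OF h u2 hu] by (simp only: right_diff_distrib)
    have lim: "((\<lambda>t. approx_form t (u n) h) \<longlongrightarrow> Y + X) (at_right 0)"
      unfolding YX[symmetric] by (rule approx_form_resolvent_tendsto[OF u h h r])
    have "approx_form t (u n) (u n) \<le> X" if "0 < t" for t
      using approx_form_le_limit[OF that u2 approx_form_resolvent_tendsto[OF u h u2 r]] r[OF u]
      by (simp add: X_def)
    moreover have "0 \<le> approx_form t (u n) (u n)" "0 \<le> approx_form t h h" if "0 < t" for t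
      using semi_inner.nonneg[OF semi_inner_approx_form[OF that]] u2 h by auto
    ultimately have "(approx_form t (u n) h)\<^sup>2 \<le> X * C" if "0 < t" "t < 1" for t
      using semi_inner.cauchy_schwarz[OF semi_inner_approx_form[OF that(1)] u2 h]
        bd[OF that] that(1) X by (meson mult_mono order_trans)
    moreover have "\<forall>\<^sub>F t in at_right (0::real). 0 < t \<and> t < 1"
      using eventually_at_right_real[of 0 1] by (auto elim: eventually_mono)
    ultimately have "\<forall>\<^sub>F t in at_right 0. (approx_form t (u n) h)\<^sup>2 \<le> X * C"
      by (auto elim: eventually_mono)
    then have XY: "(Y + X)\<^sup>2 \<le> X * C"
      by (intro tendsto_upperbound[OF tendsto_power[OF lim]]) auto
    have "X\<^sup>2 \<le> (Y + X)\<^sup>2" using X Y by (intro power_mono) auto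
    then have "X * X \<le> X * C" using XY by (simp add: power2_eq_square)
    then have XC: "X \<le> C" using X C by (cases "X = 0") auto
    have "Y\<^sup>2 \<le> (Y + X)\<^sup>2" using X Y by (intro power_mono) auto
    also have "\<dots> \<le> C * C" using XY mult_right_mono[OF XC C] by linarith
    finally have "Y \<le> C" using C by (intro power2_le_imp_le[of Y C]) (auto simp: power2_eq_square)
    then show ?thesis using XC by (simp add: X_def Y_def)
  qed
  show ?thesis
    using * by (intro resolvent_approx(1)[OF h u r, of C]) auto
qed

text \<open>The domain of the generator is dense in the energy norm. The resolvent equation tested
  with \<open>f - u n\<close> gives \<open>E (u n) f = E (u n) (u n) + Y\<close> with
  \<open>Y \<ge> 0\<close>; positivity of the energy of \<open>u n - f\<close> then yields
  \<open>E (u n) (u n) + 2 * Y \<le> E f f\<close>.\<close>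

lemma resolvent_dom_approx:
  assumes f: "f \<in> F" and e: "0 < e"
  shows "\<exists>u\<in>F. \<exists>h\<in>Lp M 2. \<exists>l. (\<forall>v\<in>F. E u v = l * ip M (\<lambda>x. h x - u x) v) \<and>
    E (\<lambda>x. u x - f x) (\<lambda>x. u x - f x) < e \<and> ip M (\<lambda>x. u x - f x) (\<lambda>x. u x - f x) < e"
proof -
  have f2: "f \<in> Lp M 2" using dom_L2D[OF f] .
  obtain u where u: "\<And>n. u n \<in> F"
    and r: "\<And>n w. w \<in> F \<Longrightarrow> E (u n) w = real (Suc n) * ip M (\<lambda>x. f x - u n x) w"
    using resolvent_seq_exists[OF f2] by blast
  have *: "E (u n) (u n) \<le> E f f \<and> real (Suc n) * ip M (\<lambda>x. f x - u n x) (\<lambda>x. f x - u n x) \<le> E f f" for n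
  proof -
    have fu: "(\<lambda>x. f x - u n x) \<in> F" by (rule form.diff_closed[OF f u])
    define Y where "Y = real (Suc n) * ip M (\<lambda>x. f x - u n x) (\<lambda>x. f x - u n x)"
    have Y: "0 \<le> Y" unfolding Y_def using L2.nonneg[OF dom_L2D[OF fu]] by simp
    have "E (u n) f - E (u n) (u n) = Y"
      using r[OF fu] form.diff_right[OF f u u] by (simp add: Y_def)
    moreover have "0 \<le> E (u n) (u n) - 2 * E (u n) f + E f f"
      using form_nonneg[OF form.diff_closed[OF u f]] form.diff_self[OF u f] by simp
    ultimately have "E (u n) (u n) + 2 * Y \<le> E f f" by simp
    then show ?thesis using Y form_nonneg[OF u, of n] by (simp add: Y_def)
  qed
  have "(\<lambda>n. E (\<lambda>x. u n x - f x) (\<lambda>x. u n x - f x)) \<longlonglongrightarrow> 0"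
    "(\<lambda>n. ip M (\<lambda>x. u n x - f x) (\<lambda>x. u n x - f x)) \<longlonglongrightarrow> 0"
    using * by (auto intro!: resolvent_approx(2,3)[OF f2 u r, of "E f f"])
  then have "\<forall>\<^sub>F n in sequentially. E (\<lambda>x. u n x - f x) (\<lambda>x. u n x - f x) < e
      \<and> ip M (\<lambda>x. u n x - f x) (\<lambda>x. u n x - f x) < e"
    using e by (intro eventually_conj order_tendstoD(2))
  then obtain n where "E (\<lambda>x. u n x - f x) (\<lambda>x. u n x - f x) < e"
      "ip M (\<lambda>x. u n x - f x) (\<lambda>x. u n x - f x) < e"
    by (auto simp: eventually_sequentially)
  then show ?thesis using u f2 r by blast
qed

text \<open>For resolvents the bound is a consequence of the monotone limit. At fixed
  \<open>t\<close> the approximating form is continuous in L2, so the bound passes to all of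
  \<open>F\<close> by approximation in both norms.\<close>

lemma approx_form_le:
  assumes t: "0 < t" and f: "f \<in> F"
  shows "approx_form t f f \<le> E f f"
proof -
  interpret A: semi_inner "Lp M 2" "approx_form t" by (rule semi_inner_approx_form[OF t])
  have f2: "f \<in> Lp M 2" using dom_L2D[OF f] .
  have bound: "approx_form t v v \<le> 2 * ip M v v / t" if v: "v \<in> Lp M 2" for v
  proof -
    have "0 \<le> ip M (P t v) v"
      using P_half[of t v v] t v L2.nonneg[OF P_L2[of "t/2" v]] by simp
    then have "ip M v v - ip M (P t v) v \<le> 2 * ip M v v" using L2.nonneg[OF v] by linarith
    then show ?thesis using t by (simp add: approx_form_def divide_right_mono)
  qed
  have approx_lim: "sqrt (approx_form t f f) \<le> sqrt (E f f) + e" if e: "0 < e" for e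
  proof -
    \<comment> \<open>The first entry makes the energy error at most \<open>e / 2\<close>; the
      second makes \<open>2 * \<delta> / t\<close> at most \<open>(e / 2)\<^sup>2\<close>, as
      \<open>bound\<close> requires.\<close>
    define \<delta> where "\<delta> = min ((e/2)\<^sup>2) (t * (e/2)\<^sup>2 / 2)"
    have \<delta>: "0 < \<delta>" using e t by (simp add: \<delta>_def)
    obtain u h l where u: "u \<in> F" and h: "h \<in> Lp M 2"
      and r: "\<And>v. v \<in> F \<Longrightarrow> E u v = l * ip M (\<lambda>x. h x - u x) v"
      and E: "E (\<lambda>x. u x - f x) (\<lambda>x. u x - f x) < \<delta>" and I: "ip M (\<lambda>x. u x - f x) (\<lambda>x. u x - f x) < \<delta>"
      using resolvent_dom_approx[OF f \<delta>] by auto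
    have u2: "u \<in> Lp M 2" using dom_L2D[OF u] .
    have d2: "(\<lambda>x. u x - f x) \<in> Lp M 2" by (rule L2.diff_closed[OF u2 f2])
    have dF: "(\<lambda>x. u x - f x) \<in> F" by (rule form.diff_closed[OF u f])
    have Au: "approx_form t u u \<le> E u u"
      using approx_form_le_limit[OF t u2 approx_form_resolvent_tendsto[OF u h u2 r]] r[OF u] by simp
    have "sqrt (approx_form t f f) \<le> sqrt (approx_form t u u) + sqrt (approx_form t (\<lambda>x. u x - f x) (\<lambda>x. u x - f x))"
      using A.triangle_diff[OF u2 f2] .
    also have "approx_form t (\<lambda>x. u x - f x) (\<lambda>x. u x - f x) \<le> (e/2)\<^sup>2"
    proof -
      have "approx_form t (\<lambda>x. u x - f x) (\<lambda>x. u x - f x) \<le> 2 * (t * (e/2)\<^sup>2 / 2) / t"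
        using bound[OF d2] I t by (intro order_trans[OF bound[OF d2]] divide_right_mono mult_left_mono) (auto simp: \<delta>_def)
      then show ?thesis using t by simp
    qed
    also have "sqrt ((e/2)\<^sup>2) = e/2" using e by simp
    also have "sqrt (approx_form t u u) \<le> sqrt (E u u)" using Au by simp
    also have "sqrt (E u u) \<le> sqrt (E f f) + sqrt (E (\<lambda>x. u x - f x) (\<lambda>x. u x - f x))"
      using form.triangle_diff'[OF u f] .
    also have "sqrt (E (\<lambda>x. u x - f x) (\<lambda>x. u x - f x)) \<le> sqrt ((e/2)\<^sup>2)"
      using E by (intro real_sqrt_le_mono) (simp add: \<delta>_def)
    also have "sqrt ((e/2)\<^sup>2) = e/2" using e by simp
    finally show ?thesis by simp
  qed
  then have "sqrt (approx_form t f f) \<le> sqrt (E f f)" by (rule field_le_epsilon)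
  then show ?thesis by simp
qed

text \<open>A three-epsilon argument around a resolvent \<open>u\<close> near \<open>f\<close>;
  \<open>approx_form_le\<close> makes the error of replacing \<open>f\<close> by \<open>u\<close>
  uniform in \<open>t\<close>.\<close>

lemma approx_form_tendsto:
  assumes f: "f \<in> F" and g: "g \<in> F"
  shows "((\<lambda>t. approx_form t f g) \<longlongrightarrow> E f g) (at_right 0)"
proof (rule tendstoI)
  fix e :: real assume e: "0 < e"
  have f2: "f \<in> Lp M 2" and g2: "g \<in> Lp M 2" using dom_L2D f g by auto
  define s where "s = sqrt (E g g) + 1"
  have s: "0 < s" "sqrt (E g g) \<le> s" using form_nonneg[OF g] by (auto simp: s_def add_nonneg_pos)
  define \<delta> where "\<delta> = (e / (3 * s))\<^sup>2"
  have \<delta>: "0 < \<delta>" using e s by (simp add: \<delta>_def)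
  obtain u h l where u: "u \<in> F" and h: "h \<in> Lp M 2"
    and r: "\<And>v. v \<in> F \<Longrightarrow> E u v = l * ip M (\<lambda>x. h x - u x) v"
    and E: "E (\<lambda>x. u x - f x) (\<lambda>x. u x - f x) < \<delta>"
    using resolvent_dom_approx[OF f \<delta>] by auto
  have u2: "u \<in> Lp M 2" using dom_L2D[OF u] .
  have dF: "(\<lambda>x. u x - f x) \<in> F" by (rule form.diff_closed[OF u f])
  have sE: "sqrt (E (\<lambda>x. u x - f x) (\<lambda>x. u x - f x)) \<le> e / (3 * s)"
    using real_sqrt_le_mono[OF less_imp_le[OF E]] e s by (simp add: \<delta>_def)
  have prod: "a * b \<le> e / 3" if "a \<le> e / (3 * s)" "b \<le> s" "0 \<le> b" for a b
  proof -
    have "a * b \<le> e / (3 * s) * s" using that e s by (intro mult_mono) auto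
    then show ?thesis using s by simp
  qed
  have E3: "\<bar>E u g - E f g\<bar> \<le> e / 3"
  proof -
    have "\<bar>E u g - E f g\<bar> \<le> sqrt (E (\<lambda>x. u x - f x) (\<lambda>x. u x - f x)) * sqrt (E g g)"
      using form.cauchy_schwarz_sqrt[OF dF g] form.diff_left[OF u f g] by simp
    also have "\<dots> \<le> e / 3" using sE s form_nonneg[OF g] by (intro prod) auto
    finally show ?thesis .
  qed
  have A3: "\<bar>approx_form t u g - approx_form t f g\<bar> \<le> e / 3" if t: "0 < t" for t
  proof -
    interpret A: semi_inner "Lp M 2" "approx_form t" by (rule semi_inner_approx_form[OF t])
    have "\<bar>approx_form t u g - approx_form t f g\<bar>
        \<le> sqrt (approx_form t (\<lambda>x. u x - f x) (\<lambda>x. u x - f x)) * sqrt (approx_form t g g)"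
      using A.cauchy_schwarz_sqrt[OF dom_L2D[OF dF] g2] A.diff_left[OF u2 f2 g2] by simp
    also have "\<dots> \<le> e / 3"
      using order_trans[OF real_sqrt_le_mono[OF approx_form_le[OF t dF]] sE]
        order_trans[OF real_sqrt_le_mono[OF approx_form_le[OF t g]] s(2)] A.nonneg[OF g2]
      by (intro prod) auto
    finally show ?thesis .
  qed
  have "((\<lambda>t. approx_form t u g) \<longlongrightarrow> E u g) (at_right 0)"
    using approx_form_resolvent_tendsto[OF u h g2 r] r[OF g] by simp
  then have "\<forall>\<^sub>F t in at_right 0. dist (approx_form t u g) (E u g) < e / 3"
    using e by (intro tendstoD) auto
  then show "\<forall>\<^sub>F t in at_right 0. dist (approx_form t f g) (E f g) < e"
    using eventually_at_right_less[of 0]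
  proof eventually_elim
    case (elim t)
    then show ?case using A3[OF elim(2)] E3 unfolding dist_real_def by argo
  qed
qed

end

section \<open>The heat kernel\<close>

text \<open>Bounded at every point, not just almost everywhere: the functions are integrated against
  the individual measures \<open>k t y\<close>, which may charge null sets of
  \<open>M\<close>.\<close>

definition bdd_meas :: "'a measure \<Rightarrow> ('a \<Rightarrow> real) set" where
  "bdd_meas M = {f \<in> borel_measurable M. \<exists>B. \<forall>x\<in>space M. \<bar>f x\<bar> \<le> B}"

lemma bdd_measI: "\<lbrakk>f \<in> borel_measurable M; \<And>x. x \<in> space M \<Longrightarrow> \<bar>f x\<bar> \<le> B\<rbrakk> \<Longrightarrow> f \<in> bdd_meas M"
  by (auto simp: bdd_meas_def)

lemma bdd_measE:
  assumes "f \<in> bdd_meas M"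
  obtains B where "f \<in> borel_measurable M" "0 \<le> B" "\<And>x. x \<in> space M \<Longrightarrow> \<bar>f x\<bar> \<le> B"
proof -
  obtain B where "f \<in> borel_measurable M" "\<forall>x\<in>space M. \<bar>f x\<bar> \<le> B"
    using assms by (auto simp: bdd_meas_def)
  then show ?thesis using that[of "max 0 B"] by fastforce
qed

lemma bdd_meas_measurable: "f \<in> bdd_meas M \<Longrightarrow> f \<in> borel_measurable M"
  by (simp add: bdd_meas_def)

lemma bdd_meas_bounded: "f \<in> bdd_meas M \<Longrightarrow> bounded (f ` space M)"
  by (auto simp: bdd_meas_def bounded_iff)

lemma bdd_meas_mult:
  assumes f: "f \<in> bdd_meas M" and g: "g \<in> bdd_meas M"
  shows "(\<lambda>x. f x * g x) \<in> bdd_meas M"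
proof -
  obtain B where B: "f \<in> borel_measurable M" "0 \<le> B" "\<And>x. x \<in> space M \<Longrightarrow> \<bar>f x\<bar> \<le> B"
    using bdd_measE[OF f] by blast
  obtain C where C: "g \<in> borel_measurable M" "0 \<le> C" "\<And>x. x \<in> space M \<Longrightarrow> \<bar>g x\<bar> \<le> C"
    using bdd_measE[OF g] by blast
  show ?thesis
    using B C by (intro bdd_measI[where B = "B * C"]) (auto simp: abs_mult intro!: mult_mono)
qed

lemma bdd_meas_square: "f \<in> bdd_meas M \<Longrightarrow> (\<lambda>x. (f x)\<^sup>2) \<in> bdd_meas M"
  using bdd_meas_mult[of f M f] by (simp add: power2_eq_square)

lemma bdd_meas_Linf: "f \<in> bdd_meas M \<Longrightarrow> f \<in> Linf M"
  by (auto simp: bdd_meas_def Linf_def)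

lemma bdd_meas_mult_integrable:
  assumes f: "f \<in> bdd_meas M" and g: "integrable M (g :: 'a \<Rightarrow> real)"
  shows "integrable M (\<lambda>x. f x * g x)"
proof -
  obtain B where B: "f \<in> borel_measurable M" "0 \<le> B" "\<And>x. x \<in> space M \<Longrightarrow> \<bar>f x\<bar> \<le> B"
    using bdd_measE[OF f] by blast
  show ?thesis
  proof (rule Bochner_Integration.integrable_bound)
    show "integrable M (\<lambda>x. B * g x)" using g by simp
    show "(\<lambda>x. f x * g x) \<in> borel_measurable M"
      using B(1) borel_measurable_integrable[OF g] by simp
    show "AE x in M. norm (f x * g x) \<le> norm (B * g x)"
      using B(2,3) by (auto simp: abs_mult intro!: mult_right_mono)
  qed
qed

lemma bdd_meas_integrable_L2:
  assumes f: "f \<in> bdd_meas M" and int: "integrable M f"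
  shows "f \<in> Lp M 2"
  using bdd_meas_mult_integrable[OF f int] bdd_meas_measurable[OF f]
  by (simp add: Lp_2_iff power2_eq_square)

text \<open>Above the level \<open>\<kappa>\<close>, write
  \<open>s = s powr (1 - r) * s powr r\<close>; the first factor decreases in
  \<open>s\<close>.\<close>

lemma le_add_powr:
  fixes s \<kappa> r :: real
  assumes "0 \<le> s" "0 < \<kappa>" "1 < r"
  shows "s \<le> \<kappa> + \<kappa> powr (1 - r) * s powr r"
proof (cases "s \<le> \<kappa>")
  case True
  have "0 \<le> \<kappa> powr (1 - r) * s powr r" by simp
  then show ?thesis using True by linarith
next
  case False
  then have "s = s powr (1 - r) * s powr r"
    using assms by (simp flip: powr_add)
  also have "\<dots> \<le> \<kappa> powr (1 - r) * s powr r"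
    using assms False by (intro mult_right_mono powr_mono2') auto
  finally show ?thesis using assms by linarith
qed

locale heat_kernel_space = heat_semigroup M E F P
  for M :: "'a measure" and E F P +
  fixes k :: "real \<Rightarrow> 'a \<Rightarrow> 'a measure"
  assumes kernel: "heat_kernel M P k"
begin

text \<open>A version of \<open>P t f\<close> with a value at every point, for which identities hold
  pointwise.\<close>

definition K :: "real \<Rightarrow> ('a \<Rightarrow> real) \<Rightarrow> 'a \<Rightarrow> real" where
  "K t f y = (\<integral>x. f x \<partial>k t y)"

text \<open>\<open>G t f / (2 * t)\<close> is the approximate energy density, that is, the
  approximate carre du champ of \<open>f\<close>.\<close>

definition G :: "real \<Rightarrow> ('a \<Rightarrow> real) \<Rightarrow> 'a \<Rightarrow> real" where
  "G t f y = (\<integral>x. (f x - f y)\<^sup>2 \<partial>k t y)"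

lemma kernel_measurable:
  assumes "0 \<le> t"
  shows "k t \<in> measurable M (subprob_algebra M)"
  using kernel assms by (intro measurable_prob_algebraD) (auto simp: heat_kernel_def)

lemma kernel_prob:
  assumes "0 \<le> t" "y \<in> space M"
  shows "prob_space (k t y)" "sets (k t y) = sets M" "space (k t y) = space M"
proof -
  have "k t y \<in> space (prob_algebra M)"
    using kernel assms by (intro measurable_space[of "k t" M]) (auto simp: heat_kernel_def)
  then show "prob_space (k t y)" "sets (k t y) = sets M"
    by (auto simp: space_prob_algebra)
  then show "space (k t y) = space M" by (intro sets_eq_imp_space_eq)
qed

lemma kernel_integrable:
  assumes t: "0 \<le> t" and y: "y \<in> space M" and f: "f \<in> bdd_meas M"
  shows "integrable (k t y) f"
proof -
  obtain B where B: "f \<in> borel_measurable M" "\<And>x. x \<in> space M \<Longrightarrow> \<bar>f x\<bar> \<le> B"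
    using bdd_measE[OF f] by blast
  interpret prob_space "k t y" by (rule kernel_prob[OF t y])
  show ?thesis
    using B kernel_prob[OF t y]
    by (intro integrable_const_bound[where B = B]) (auto cong: measurable_cong_sets)
qed

lemma K_measurable:
  assumes t: "0 \<le> t" and f: "f \<in> borel_measurable M"
  shows "K t f \<in> borel_measurable M"
  unfolding K_def[abs_def]
  by (rule measurable_compose[OF kernel_measurable[OF t] integral_measurable_subprob_algebra[OF f]])

lemma P_eq_K: "\<lbrakk>0 \<le> t; f \<in> bdd_meas M\<rbrakk> \<Longrightarrow> AE x in M. P t f x = K t f x"
  using kernel bdd_meas_measurable bdd_meas_bounded unfolding heat_kernel_def K_def by blast

lemma K_L2:
  assumes t: "0 \<le> t" and f: "f \<in> bdd_meas M" "f \<in> Lp M 2"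
  shows "K t f \<in> Lp M 2"
proof -
  have "P t f \<in> Lp M 2" using P_L2 t f by simp
  moreover have m: "K t f \<in> borel_measurable M" using K_measurable t f by (simp add: Lp_2_iff)
  ultimately have "integrable M (\<lambda>x. (K t f x)\<^sup>2)"
    using P_eq_K[OF t f(1)] by (subst integrable_cong_AE[where g = "\<lambda>x. (P t f x)\<^sup>2"]) (auto simp: Lp_2_iff)
  then show ?thesis using m by (simp add: Lp_2_iff)
qed

lemma ip_P_eq_K:
  assumes t: "0 \<le> t" and f: "f \<in> bdd_meas M" "f \<in> Lp M 2" and g: "g \<in> Lp M 2"
  shows "ip M (P t f) g = ip M (K t f) g"
  using P_L2[OF t f(2)] K_L2[OF t f] g P_eq_K[OF t f(1)]
  by (intro ip_cong_AE) (auto simp: Lp_2_iff)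

lemma K_integrable:
  assumes t: "0 \<le> t" and f: "f \<in> bdd_meas M" "integrable M f"
  shows "integrable M (K t f)"
proof -
  have "P t f \<in> Lp M 1"
    by (rule closed_under[OF t Lp_in_lebesgue_spaces]) (use f in \<open>auto simp: Lp_1_iff\<close>)
  then have "integrable M (P t f)" by (simp add: Lp_1_iff)
  moreover have "K t f \<in> borel_measurable M" using K_measurable t f(2) by simp
  ultimately show ?thesis
    using P_eq_K[OF t f(1)] by (subst integrable_cong_AE[where g = "P t f"]) auto
qed

text \<open>Rests on the duality of L1 and L-infinity rather than on self-adjointness in L2, so that
  \<open>f\<close> can be the constant 1 or the indicator of a set of infinite measure.\<close>

lemma K_sym:
  assumes t: "0 \<le> t" and f: "f \<in> bdd_meas M" and g: "g \<in> bdd_meas M" "integrable M g"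
  shows "(\<integral>y. K t f y * g y \<partial>M) = (\<integral>y. f y * K t g y \<partial>M)"
proof -
  have mf: "f \<in> borel_measurable M" "K t f \<in> borel_measurable M" "K t g \<in> borel_measurable M"
    using bdd_meas_measurable[OF f] bdd_meas_measurable[OF g(1)] K_measurable[OF t] by auto
  have "P t f \<in> Linf M"
    by (rule closed_under[OF t _ bdd_meas_Linf[OF f]]) (simp add: lebesgue_spaces_def)
  then have Pf: "P t f \<in> borel_measurable M" by (simp add: Linf_def)
  have g1: "g \<in> Lp M 1" using g(2) by (simp add: Lp_1_iff)
  have Pg: "P t g \<in> borel_measurable M"
    using closed_under[OF t Lp_in_lebesgue_spaces g1] by (simp add: Lp_def)
  have "(\<integral>y. K t f y * g y \<partial>M) = (\<integral>y. P t f y * g y \<partial>M)"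
    using P_eq_K[OF t f] mf Pf g(2) by (intro integral_cong_AE) auto
  also have "\<dots> = (\<integral>y. f y * P t g y \<partial>M)"
    by (rule duality[OF t bdd_meas_Linf[OF f] g1])
  also have "\<dots> = (\<integral>y. f y * K t g y \<partial>M)"
    using P_eq_K[OF t g(1)] mf Pg by (intro integral_cong_AE) auto
  finally show ?thesis .
qed

lemma G_eq:
  assumes t: "0 \<le> t" and y: "y \<in> space M" and f: "f \<in> bdd_meas M"
  shows "G t f y = K t (\<lambda>x. (f x)\<^sup>2) y - 2 * f y * K t f y + (f y)\<^sup>2"
proof -
  interpret prob_space "k t y" by (rule kernel_prob[OF t y])
  note int = kernel_integrable[OF t y f] kernel_integrable[OF t y bdd_meas_square[OF f]]
  have "G t f y = (\<integral>x. (f x)\<^sup>2 - 2 * f y * f x + (f y)\<^sup>2 \<partial>k t y)"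
    unfolding G_def by (intro Bochner_Integration.integral_cong) (auto simp: power2_diff algebra_simps)
  also have "\<dots> = K t (\<lambda>x. (f x)\<^sup>2) y - 2 * f y * K t f y + (f y)\<^sup>2"
    using int by (simp add: K_def prob_space)
  finally show ?thesis .
qed

lemma G_nonneg: "0 \<le> G t f y"
  by (simp add: G_def)

lemma G_integrable:
  assumes t: "0 \<le> t" and f: "f \<in> bdd_meas M" "f \<in> Lp M 2"
  shows "integrable M (G t f)"
proof -
  have "integrable M (\<lambda>y. K t (\<lambda>x. (f x)\<^sup>2) y - 2 * (f y * K t f y) + (f y)\<^sup>2)"
    using K_integrable[OF t bdd_meas_square[OF f(1)]] Lp_2_mult_integrable[OF f(2) K_L2[OF t f]] f(2)
    by (simp add: Lp_2_iff)
  then show ?thesis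
    by (subst Bochner_Integration.integrable_cong[OF refl, of M "G t f"]) (auto simp: G_eq[OF t _ f(1)] mult.assoc)
qed

lemma integral_mult_G:
  assumes t: "0 \<le> t" and f: "f \<in> bdd_meas M" "f \<in> Lp M 2" and \<phi>: "\<phi> \<in> bdd_meas M"
  shows "(\<integral>y. \<phi> y * G t f y \<partial>M) =
     (\<integral>y. \<phi> y * K t (\<lambda>x. (f x)\<^sup>2) y \<partial>M) - 2 * (\<integral>y. \<phi> y * (f y * K t f y) \<partial>M) + (\<integral>y. \<phi> y * (f y)\<^sup>2 \<partial>M)"
proof -
  have int: "integrable M (\<lambda>y. \<phi> y * K t (\<lambda>x. (f x)\<^sup>2) y)" "integrable M (\<lambda>y. \<phi> y * (f y * K t f y))"
    "integrable M (\<lambda>y. \<phi> y * (f y)\<^sup>2)"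
    using K_integrable[OF t bdd_meas_square[OF f(1)]] Lp_2_mult_integrable[OF f(2) K_L2[OF t f]] f(2)
    by (auto intro!: bdd_meas_mult_integrable[OF \<phi>] simp: Lp_2_iff)
  have "(\<integral>y. \<phi> y * G t f y \<partial>M) =
      (\<integral>y. \<phi> y * K t (\<lambda>x. (f x)\<^sup>2) y - 2 * (\<phi> y * (f y * K t f y)) + \<phi> y * (f y)\<^sup>2 \<partial>M)"
    by (intro Bochner_Integration.integral_cong) (auto simp: G_eq[OF t _ f(1)] algebra_simps)
  then show ?thesis using int by simp
qed

lemma K_const:
  assumes "0 \<le> t" "y \<in> space M"
  shows "K t (\<lambda>_. c) y = c"
proof -
  interpret prob_space "k t y" by (rule kernel_prob[OF assms])
  show ?thesis by (simp add: K_def prob_space)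
qed

text \<open>Invariance of \<open>M\<close>: symmetry against the constant 1. Conservativeness enters
  through the total mass 1 of the kernels.\<close>

lemma integral_K:
  assumes t: "0 \<le> t" and g: "g \<in> bdd_meas M" "integrable M g"
  shows "(\<integral>y. K t g y \<partial>M) = (\<integral>y. g y \<partial>M)"
proof -
  have "(\<integral>y. K t g y \<partial>M) = (\<integral>y. K t (\<lambda>_. 1) y * g y \<partial>M)"
    using K_sym[OF t bdd_measI[where f = "\<lambda>_. 1" and B = 1] g] by simp
  also have "\<dots> = (\<integral>y. g y \<partial>M)"
    by (intro Bochner_Integration.integral_cong) (auto simp: K_const[OF t])
  finally show ?thesis .
qed

text \<open>By invariance the integrals of \<open>K t (\<lambda>x. (f x)\<^sup>2)\<close> and of the
  square of \<open>f\<close> coincide, whence the factor 2.\<close>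

lemma approx_form_self_eq:
  assumes t: "0 < t" and f: "f \<in> bdd_meas M" "f \<in> Lp M 2"
  shows "approx_form t f f = (\<integral>y. G t f y \<partial>M) / (2 * t)"
proof -
  have t0: "0 \<le> t" using t by simp
  have "(\<integral>y. G t f y \<partial>M) = (\<integral>y. K t (\<lambda>x. (f x)\<^sup>2) y \<partial>M) - 2 * ip M (K t f) f + ip M f f"
    using integral_mult_G[OF t0 f bdd_measI[where f = "\<lambda>_. 1" and B = 1]]
    by (simp add: ip_def power2_eq_square mult.commute)
  also have "\<dots> = 2 * (ip M f f - ip M (P t f) f)"
    using integral_K[OF t0 bdd_meas_square[OF f(1)]] f ip_P_eq_K[OF t0 f f(2)]
    by (simp add: Lp_2_iff ip_self)
  finally have "(\<integral>y. G t f y \<partial>M) = 2 * (ip M f f - ip M (P t f) f)" .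
  moreover have "a / t = 2 * a / (2 * t)" for a by simp
  ultimately show ?thesis unfolding approx_form_def by (simp only:)
qed

text \<open>The defining formula of the energy measure, with \<open>approx_form t\<close> in place
  of \<open>E\<close>. After symmetry has moved the semigroup onto \<open>f\<close> and its square,
  the terms are those of \<open>G\<close> expanded and weighted by \<open>\<phi>\<close>.\<close>

lemma approx_form_energy_eq:
  assumes t: "0 < t" and f: "f \<in> bdd_meas M" "f \<in> Lp M 2" and \<phi>: "\<phi> \<in> bdd_meas M" "\<phi> \<in> Lp M 2"
  shows "approx_form t (\<lambda>x. f x * \<phi> x) f - approx_form t \<phi> (\<lambda>x. (f x)\<^sup>2) / 2
           = (\<integral>y. \<phi> y * G t f y \<partial>M) / (2 * t)"
proof -
  have t0: "0 \<le> t" using t by simp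
  have f\<phi>: "(\<lambda>x. f x * \<phi> x) \<in> Lp M 2"
    by (rule bdd_meas_integrable_L2[OF bdd_meas_mult[OF f(1) \<phi>(1)] Lp_2_mult_integrable[OF f(2) \<phi>(2)]])
  have ff: "integrable M (\<lambda>x. (f x)\<^sup>2)" using f(2) by (simp add: Lp_2_iff)
  have f2: "(\<lambda>x. (f x)\<^sup>2) \<in> Lp M 2"
    by (rule bdd_meas_integrable_L2[OF bdd_meas_square[OF f(1)] ff])
  have 1: "ip M (P t (\<lambda>x. f x * \<phi> x)) f = (\<integral>y. \<phi> y * (f y * K t f y) \<partial>M)"
  proof -
    have "ip M (P t (\<lambda>x. f x * \<phi> x)) f = ip M (P t f) (\<lambda>x. f x * \<phi> x)"
      using P_sym[OF t0 f(2) f\<phi>] P_sym[OF t0 f\<phi> f(2)] L2.sym[OF P_L2[OF t0 f(2)] f\<phi>] by simp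
    also have "\<dots> = ip M (K t f) (\<lambda>x. f x * \<phi> x)"
      by (rule ip_P_eq_K[OF t0 f f\<phi>])
    finally show ?thesis by (simp add: ip_def mult_ac)
  qed
  have 2: "ip M (P t \<phi>) (\<lambda>x. (f x)\<^sup>2) = (\<integral>y. \<phi> y * K t (\<lambda>x. (f x)\<^sup>2) y \<partial>M)"
    using ip_P_eq_K[OF t0 \<phi> f2] K_sym[OF t0 \<phi>(1) bdd_meas_square[OF f(1)] ff] by (simp add: ip_def)
  have 3: "ip M (\<lambda>x. f x * \<phi> x) f = (\<integral>y. \<phi> y * (f y)\<^sup>2 \<partial>M)"
    "ip M \<phi> (\<lambda>x. (f x)\<^sup>2) = (\<integral>y. \<phi> y * (f y)\<^sup>2 \<partial>M)"
    by (simp_all add: ip_def power2_eq_square mult_ac)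
  show ?thesis
    unfolding approx_form_def 1 2 3 integral_mult_G[OF t0 f \<phi>(1)]
    using t by (simp add: field_simps)
qed

text \<open>Splitting the difference of products as
  \<open>f x * (g x - g y) + g y * (f x - f y)\<close> bounds \<open>G\<close> of the product by
  those of the factors. Needed so that the products in the energy measure formula lie in
  \<open>F\<close>.\<close>

lemma dom_mult:
  assumes f: "f \<in> bdd_meas M" "f \<in> F" and g: "g \<in> bdd_meas M" "g \<in> F"
  shows "(\<lambda>x. f x * g x) \<in> F"
proof -
  obtain A where A: "f \<in> borel_measurable M" "0 \<le> A" "\<And>x. x \<in> space M \<Longrightarrow> \<bar>f x\<bar> \<le> A"
    using bdd_measE[OF f(1)] by blast
  obtain B where B: "g \<in> borel_measurable M" "0 \<le> B" "\<And>x. x \<in> space M \<Longrightarrow> \<bar>g x\<bar> \<le> B"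
    using bdd_measE[OF g(1)] by blast
  have f2: "f \<in> Lp M 2" and g2: "g \<in> Lp M 2" using f g dom_L2D by auto
  have fg: "(\<lambda>x. f x * g x) \<in> bdd_meas M" by (rule bdd_meas_mult[OF f(1) g(1)])
  have fg2: "(\<lambda>x. f x * g x) \<in> Lp M 2"
    by (rule bdd_meas_integrable_L2[OF fg Lp_2_mult_integrable[OF f2 g2]])
  show ?thesis
  proof (rule dom_if_approx_form_bounded[OF fg2])
    fix t :: real assume t: "0 < t" "t < 1"
    then have t0: "0 \<le> t" by simp
    have "G t (\<lambda>x. f x * g x) y \<le> 2 * A\<^sup>2 * G t g y + 2 * B\<^sup>2 * G t f y" if y: "y \<in> space M" for y
    proof -
      have *: "(f x * g x - f y * g y)\<^sup>2 \<le> 2 * A\<^sup>2 * (g x - g y)\<^sup>2 + 2 * B\<^sup>2 * (f x - f y)\<^sup>2"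
        if x: "x \<in> space M" for x
      proof -
        have "f x * g x - f y * g y = f x * (g x - g y) + g y * (f x - f y)"
          by (simp add: algebra_simps)
        then have "(f x * g x - f y * g y)\<^sup>2 \<le> 2 * (f x * (g x - g y))\<^sup>2 + 2 * (g y * (f x - f y))\<^sup>2"
          using sum_squares_bound[of "f x * (g x - g y)" "g y * (f x - f y)"]
          by (simp add: power2_sum)
        also have "\<dots> = 2 * ((f x)\<^sup>2 * (g x - g y)\<^sup>2) + 2 * ((g y)\<^sup>2 * (f x - f y)\<^sup>2)"
          by (simp add: power_mult_distrib)
        also have "\<dots> \<le> 2 * (A\<^sup>2 * (g x - g y)\<^sup>2) + 2 * (B\<^sup>2 * (f x - f y)\<^sup>2)"
          using A(2) A(3)[OF x] B(2) B(3)[OF y]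
          by (intro add_mono mult_left_mono mult_right_mono) (auto simp: abs_le_square_iff[symmetric])
        finally show ?thesis by simp
      qed
      have d: "(\<lambda>x. (h x - h y)\<^sup>2) \<in> bdd_meas M" if "h \<in> bdd_meas M" for h
      proof -
        obtain C where C: "h \<in> borel_measurable M" "\<And>x. x \<in> space M \<Longrightarrow> \<bar>h x\<bar> \<le> C"
          using bdd_measE[OF \<open>h \<in> bdd_meas M\<close>] by blast
        have "(\<lambda>x. h x - h y) \<in> bdd_meas M"
          using C(1) C(2) C(2)[OF y] by (intro bdd_measI[where B = "2 * C"]) fastforce+
        then show ?thesis by (rule bdd_meas_square)
      qed
      have "G t (\<lambda>x. f x * g x) y \<le> (\<integral>x. 2 * A\<^sup>2 * (g x - g y)\<^sup>2 + 2 * B\<^sup>2 * (f x - f y)\<^sup>2 \<partial>k t y)"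
        unfolding G_def using * kernel_prob(3)[OF t0 y] kernel_integrable[OF t0 y d] fg f(1) g(1)
        by (intro integral_mono) auto
      also have "\<dots> = 2 * A\<^sup>2 * G t g y + 2 * B\<^sup>2 * G t f y"
        unfolding G_def using kernel_integrable[OF t0 y d] f(1) g(1) by simp
      finally show ?thesis .
    qed
    then have "(\<integral>y. G t (\<lambda>x. f x * g x) y \<partial>M) \<le> (\<integral>y. 2 * A\<^sup>2 * G t g y + 2 * B\<^sup>2 * G t f y \<partial>M)"
      using G_integrable[OF t0 fg fg2] G_integrable[OF t0 f(1) f2] G_integrable[OF t0 g(1) g2]
      by (intro integral_mono) auto
    also have "\<dots> = 2 * A\<^sup>2 * (\<integral>y. G t g y \<partial>M) + 2 * B\<^sup>2 * (\<integral>y. G t f y \<partial>M)"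
      using G_integrable[OF t0 f(1) f2] G_integrable[OF t0 g(1) g2] by simp
    finally have "approx_form t (\<lambda>x. f x * g x) (\<lambda>x. f x * g x)
        \<le> 2 * A\<^sup>2 * approx_form t g g + 2 * B\<^sup>2 * approx_form t f f"
      unfolding approx_form_self_eq[OF t(1) fg fg2] approx_form_self_eq[OF t(1) f(1) f2]
        approx_form_self_eq[OF t(1) g(1) g2]
      using t by (simp add: field_simps)
    also have "\<dots> \<le> 2 * A\<^sup>2 * E g g + 2 * B\<^sup>2 * E f f"
      using approx_form_le[OF t(1)] f g by (intro add_mono mult_left_mono) auto
    finally show "approx_form t (\<lambda>x. f x * g x) (\<lambda>x. f x * g x) \<le> 2 * A\<^sup>2 * E g g + 2 * B\<^sup>2 * E f f" .
  qed
qed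

lemma energy_tendsto:
  assumes f: "f \<in> bdd_meas M" "f \<in> F" and \<phi>: "\<phi> \<in> bdd_meas M" "\<phi> \<in> F"
  shows "((\<lambda>t. (\<integral>y. \<phi> y * G t f y \<partial>M) / (2 * t))
           \<longlongrightarrow> E (\<lambda>x. f x * \<phi> x) f - E \<phi> (\<lambda>x. (f x)\<^sup>2) / 2) (at_right 0)"
proof (rule Lim_transform_eventually)
  have ff: "(\<lambda>x. (f x)\<^sup>2) \<in> F" using dom_mult[OF f f] by (simp add: power2_eq_square)
  show "((\<lambda>t. approx_form t (\<lambda>x. f x * \<phi> x) f - approx_form t \<phi> (\<lambda>x. (f x)\<^sup>2) / 2)
           \<longlongrightarrow> E (\<lambda>x. f x * \<phi> x) f - E \<phi> (\<lambda>x. (f x)\<^sup>2) / 2) (at_right 0)"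
    by (intro tendsto_diff tendsto_divide tendsto_const approx_form_tendsto dom_mult f \<phi> ff) auto
  show "\<forall>\<^sub>F t in at_right 0. approx_form t (\<lambda>x. f x * \<phi> x) f - approx_form t \<phi> (\<lambda>x. (f x)\<^sup>2) / 2
      = (\<integral>y. \<phi> y * G t f y \<partial>M) / (2 * t)"
    using eventually_at_right_less[of 0]
    by eventually_elim (use f \<phi> dom_L2D in \<open>auto intro!: approx_form_energy_eq\<close>)
qed

text \<open>The integrand \<open>(h x - h y)\<^sup>2\<close> vanishes unless \<open>x\<close> or \<open>y\<close> lies in the set where \<open>h\<close> does
  not vanish, so by symmetry of the kernel it is enough to let \<open>y\<close> range over that set.\<close>

lemma approx_form_le_support:
  assumes t: "0 < t" and h: "h \<in> bdd_meas M" "h \<in> Lp M 2"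
  defines "A \<equiv> {x \<in> space M. h x \<noteq> 0}"
  shows "approx_form t h h \<le> (\<integral>y. indicator A y * G t h y \<partial>M) / t"
proof -
  have t0: "0 \<le> t" using t by simp
  have hm[measurable]: "h \<in> borel_measurable M" using bdd_meas_measurable[OF h(1)] .
  have A[measurable]: "A \<in> sets M" unfolding A_def by measurable
  have hh: "integrable M (\<lambda>x. (h x)\<^sup>2)" using h(2) by (simp add: Lp_2_iff)
  define c where "c = (\<lambda>x. indicator (space M - A) x :: real)"
  have c: "c \<in> bdd_meas M" unfolding c_def by (intro bdd_measI[where B = 1]) (auto simp: indicator_def)
  have iA: "(\<lambda>x. indicator A x :: real) \<in> bdd_meas M"
    by (intro bdd_measI[where B = 1]) (auto simp: indicator_def)
  have Gi: "integrable M (G t h)" by (rule G_integrable[OF t0 h])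
  have split: "(\<integral>y. G t h y \<partial>M) = (\<integral>y. indicator A y * G t h y \<partial>M) + (\<integral>y. c y * G t h y \<partial>M)"
  proof -
    have "(\<integral>y. G t h y \<partial>M) = (\<integral>y. indicator A y * G t h y + c y * G t h y \<partial>M)"
      by (intro Bochner_Integration.integral_cong) (auto simp: c_def indicator_def)
    then show ?thesis
      using bdd_meas_mult_integrable[OF c Gi] bdd_meas_mult_integrable[OF iA Gi] by simp
  qed
  \<comment> \<open>Where \<open>c\<close> is nonzero \<open>h\<close> vanishes, so only the first
    term of \<open>G_eq\<close> survives; symmetry then moves the kernel onto
    \<open>c\<close>.\<close>
  have "(\<integral>y. c y * G t h y \<partial>M) = (\<integral>y. c y * K t (\<lambda>x. (h x)\<^sup>2) y \<partial>M)"
    by (intro Bochner_Integration.integral_cong) (auto simp: c_def indicator_def A_def G_eq[OF t0 _ h(1)])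
  also have "\<dots> = (\<integral>y. K t c y * (h y)\<^sup>2 \<partial>M)"
    using K_sym[OF t0 c bdd_meas_square[OF h(1)] hh] by simp
  also have "\<dots> \<le> (\<integral>y. indicator A y * G t h y \<partial>M)"
  proof (rule integral_mono)
    have "K t c \<in> bdd_meas M"
    proof (rule bdd_measI[where B = 1])
      show "K t c \<in> borel_measurable M" using K_measurable[OF t0 bdd_meas_measurable[OF c]] .
      fix y assume y: "y \<in> space M"
      interpret prob_space "k t y" by (rule kernel_prob[OF t0 y])
      have "0 \<le> K t c y" by (simp add: K_def c_def)
      moreover have "K t c y \<le> (\<integral>x. 1 \<partial>k t y)"
        unfolding K_def using kernel_integrable[OF t0 y c]
        by (intro integral_mono) (auto simp: c_def indicator_def)
      ultimately show "\<bar>K t c y\<bar> \<le> 1" by (simp add: prob_space)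
    qed
    then show "integrable M (\<lambda>y. K t c y * (h y)\<^sup>2)" by (rule bdd_meas_mult_integrable[OF _ hh])
    show "integrable M (\<lambda>y. indicator A y * G t h y)" by (rule bdd_meas_mult_integrable[OF iA Gi])
    fix y assume y: "y \<in> space M"
    show "K t c y * (h y)\<^sup>2 \<le> indicator A y * G t h y"
    proof (cases "y \<in> A")
      case True
      have d: "(\<lambda>x. (h x - h y)\<^sup>2) \<in> bdd_meas M"
      proof -
        obtain C where C: "\<And>x. x \<in> space M \<Longrightarrow> \<bar>h x\<bar> \<le> C"
          using bdd_measE[OF h(1)] by blast
        have "(\<lambda>x. h x - h y) \<in> bdd_meas M"
          using C C[OF y] by (intro bdd_measI[where B = "2 * C"]) fastforce+
        then show ?thesis by (rule bdd_meas_square)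
      qed
      \<comment> \<open>Where \<open>c x = 1\<close>, \<open>h x = 0\<close>, so the integrand
        equals \<open>(h x - h y)\<^sup>2\<close>; elsewhere it is 0.\<close>
      have "K t c y * (h y)\<^sup>2 = (\<integral>x. c x * (h y)\<^sup>2 \<partial>k t y)" by (simp add: K_def)
      also have "\<dots> \<le> G t h y"
        unfolding G_def using kernel_integrable[OF t0 y c] kernel_integrable[OF t0 y d]
        by (intro integral_mono) (auto simp: c_def indicator_def A_def)
      finally show ?thesis using True by simp
    next
      case False
      then show ?thesis using y by (simp add: A_def)
    qed
  qed
  finally have "(\<integral>y. G t h y \<partial>M) \<le> 2 * (\<integral>y. indicator A y * G t h y \<partial>M)"
    using split by simp
  then show ?thesis
    unfolding approx_form_self_eq[OF t h] using t by (simp add: field_simps)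
qed

text \<open>Splitting \<open>s = (h x - h y)\<^sup>2 / t\<close> at the level \<open>\<kappa>\<close> shows that the approximating energy densities are
  uniformly integrable as \<open>t\<close> tends to 0; this is where \<open>p = 2 r > 2\<close> enters.\<close>

lemma energy_density_bound:
  assumes t: "0 < t" and h: "h \<in> bdd_meas M" "h \<in> Lp M 2" and r: "1 < r" and C: "0 \<le> C"
    and besov: "(\<integral>\<^sup>+y. (\<integral>\<^sup>+x. ennreal (\<bar>h x - h y\<bar> powr (2 * r)) \<partial>k t y) \<partial>M) \<le> ennreal (C * t powr r)"
    and \<psi>: "integrable M \<psi>" "\<And>y. 0 \<le> \<psi> y" "\<And>y. \<psi> y \<le> 1" and \<kappa>: "0 < \<kappa>"
  shows "(\<integral>y. \<psi> y * G t h y \<partial>M) / t \<le> \<kappa> * (\<integral>y. \<psi> y \<partial>M) + \<kappa> powr (1 - r) * C"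
proof -
  have t0: "0 \<le> t" using t by simp
  have hm[measurable]: "h \<in> borel_measurable M" using bdd_meas_measurable[OF h(1)] .
  have \<psi>m[measurable]: "\<psi> \<in> borel_measurable M" using \<psi>(1) by simp
  have \<psi>b: "\<psi> \<in> bdd_meas M" using \<psi>(2,3) by (intro bdd_measI[where B = 1]) (auto simp: abs_le_iff intro: order_trans[OF _ \<psi>(2)])
  define H where "H y = (\<integral>\<^sup>+x. ennreal (\<bar>h x - h y\<bar> powr (2 * r)) \<partial>k t y)" for y
  have Hm[measurable]: "H \<in> borel_measurable M"
    unfolding H_def[abs_def]
    by (rule nn_integral_measurable_subprob_algebra2[OF _ kernel_measurable[OF t0]]) measurable
  \<comment> \<open>The level for the unscaled square is \<open>t * \<kappa>\<close>.\<close>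
  define b where "b = (t * \<kappa>) powr (1 - r)"
  have b: "0 \<le> b" by (simp add: b_def)
  have G_le: "ennreal (G t h y) \<le> ennreal (t * \<kappa>) + ennreal b * H y" if y: "y \<in> space M" for y
  proof -
    interpret prob_space "k t y" by (rule kernel_prob[OF t0 y])
    have hm'[measurable]: "h \<in> borel_measurable (k t y)"
      using hm measurable_cong_sets[OF kernel_prob(2)[OF t0 y] refl] by blast
    obtain B where B: "\<And>x. x \<in> space M \<Longrightarrow> \<bar>h x\<bar> \<le> B" using bdd_measE[OF h(1)] by blast
    have "(\<lambda>x. h x - h y) \<in> bdd_meas M"
      using B B[OF y] by (intro bdd_measI[where B = "2 * B"]) fastforce+
    then have int: "integrable (k t y) (\<lambda>x. (h x - h y)\<^sup>2)"
      by (intro kernel_integrable[OF t0 y] bdd_meas_square)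
    have "ennreal (G t h y) = (\<integral>\<^sup>+x. ennreal ((h x - h y)\<^sup>2) \<partial>k t y)"
      unfolding G_def using int by (intro nn_integral_eq_integral[symmetric]) auto
    also have "\<dots> \<le> (\<integral>\<^sup>+x. ennreal (t * \<kappa>) + ennreal b * ennreal (\<bar>h x - h y\<bar> powr (2 * r)) \<partial>k t y)"
    proof (rule nn_integral_mono)
      fix x
      have "((h x - h y)\<^sup>2) powr r = \<bar>h x - h y\<bar> powr (2 * r)"
        unfolding abs_powr_two[symmetric] powr_powr ..
      then have "(h x - h y)\<^sup>2 \<le> t * \<kappa> + b * \<bar>h x - h y\<bar> powr (2 * r)"
        using le_add_powr[of "(h x - h y)\<^sup>2" "t * \<kappa>" r] t \<kappa> r by (simp add: b_def)
      then show "ennreal ((h x - h y)\<^sup>2) \<le> ennreal (t * \<kappa>) + ennreal b * ennreal (\<bar>h x - h y\<bar> powr (2 * r))"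
        using t \<kappa> b by (simp flip: ennreal_mult ennreal_plus)
    qed
    also have "\<dots> = ennreal (t * \<kappa>) + ennreal b * H y"
      by (simp add: nn_integral_add nn_integral_cmult H_def emeasure_space_1)
    finally show ?thesis .
  qed
  have int: "integrable M (\<lambda>y. \<psi> y * G t h y)"
    by (rule bdd_meas_mult_integrable[OF \<psi>b G_integrable[OF t0 h]])
  have nonneg: "0 \<le> t * \<kappa> * (\<integral>y. \<psi> y \<partial>M)" "0 \<le> b * (C * t powr r)"
    using t \<kappa> \<psi>(2) b C by simp_all
  have "ennreal (\<integral>y. \<psi> y * G t h y \<partial>M) = (\<integral>\<^sup>+y. ennreal (\<psi> y * G t h y) \<partial>M)"
    using int \<psi>(2) G_nonneg by (intro nn_integral_eq_integral[symmetric]) auto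
  also have "\<dots> \<le> (\<integral>\<^sup>+y. ennreal (t * \<kappa>) * ennreal (\<psi> y) + ennreal b * H y \<partial>M)"
  proof (rule nn_integral_mono)
    fix y assume y: "y \<in> space M"
    have "ennreal (\<psi> y * G t h y) = ennreal (\<psi> y) * ennreal (G t h y)"
      using \<psi>(2) G_nonneg by (simp add: ennreal_mult)
    also have "\<dots> \<le> ennreal (\<psi> y) * (ennreal (t * \<kappa>) + ennreal b * H y)"
      by (rule mult_left_mono[OF G_le[OF y]]) simp
    also have "\<dots> = ennreal (t * \<kappa>) * ennreal (\<psi> y) + ennreal (\<psi> y) * (ennreal b * H y)"
      by (simp add: distrib_left mult.commute)
    also have "\<dots> \<le> ennreal (t * \<kappa>) * ennreal (\<psi> y) + 1 * (ennreal b * H y)"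
      using \<psi>(3)[of y] by (intro add_left_mono mult_right_mono) auto
    finally show "ennreal (\<psi> y * G t h y) \<le> ennreal (t * \<kappa>) * ennreal (\<psi> y) + ennreal b * H y" by simp
  qed
  also have "\<dots> = ennreal (t * \<kappa>) * (\<integral>\<^sup>+y. ennreal (\<psi> y) \<partial>M) + ennreal b * (\<integral>\<^sup>+y. H y \<partial>M)"
    by (simp add: nn_integral_add nn_integral_cmult)
  also have "\<dots> \<le> ennreal (t * \<kappa>) * ennreal (\<integral>y. \<psi> y \<partial>M) + ennreal b * ennreal (C * t powr r)"
    using besov \<psi> by (intro add_mono mult_left_mono) (auto simp: H_def nn_integral_eq_integral)
  also have "\<dots> = ennreal (t * \<kappa> * (\<integral>y. \<psi> y \<partial>M) + b * (C * t powr r))"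
    using nonneg t \<kappa> b \<psi>(2) C by (simp add: ennreal_mult ennreal_plus)
  finally have "(\<integral>y. \<psi> y * G t h y \<partial>M) \<le> t * \<kappa> * (\<integral>y. \<psi> y \<partial>M) + b * (C * t powr r)"
    by (rule iffD1[OF ennreal_le_iff, rotated]) (use nonneg in linarith)
  \<comment> \<open>The factor \<open>t powr (1 - r)\<close> of \<open>b\<close> against
    \<open>t powr r\<close> leaves exactly one \<open>t\<close>, which the final division removes:
    this is why the Besov exponent 1/2 is the right one.\<close>
  also have "b * (C * t powr r) = t * (\<kappa> powr (1 - r) * C)"
  proof -
    have "t powr (1 - r) * t powr r = t" using t by (simp flip: powr_add)
    then show ?thesis unfolding b_def using t \<kappa> by (simp add: powr_mult mult_ac)
  qed
  finally have "(\<integral>y. \<psi> y * G t h y \<partial>M) \<le> t * (\<kappa> * (\<integral>y. \<psi> y \<partial>M) + \<kappa> powr (1 - r) * C)"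
    by (simp add: algebra_simps)
  then show ?thesis using t by (simp add: divide_le_eq mult.commute)
qed

text \<open>The density bound at level 1, weighted by the indicator of the set where
  \<open>h\<close> is nonzero, is finite because that set has finite measure.\<close>

lemma dom_if_besov_bound:
  assumes h: "h \<in> bdd_meas M" "h \<in> Lp M 2" and r: "1 < r" and C: "0 \<le> C"
    and besov: "\<And>t. 0 < t \<Longrightarrow>
      (\<integral>\<^sup>+y. (\<integral>\<^sup>+x. ennreal (\<bar>h x - h y\<bar> powr (2 * r)) \<partial>k t y) \<partial>M) \<le> ennreal (C * t powr r)"
    and supp: "emeasure M {x \<in> space M. h x \<noteq> 0} < \<infinity>"
  shows "h \<in> F"
proof (rule dom_if_approx_form_bounded[OF h(2)])
  fix t :: real assume t: "0 < t" "t < 1"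
  let ?A = "{x \<in> space M. h x \<noteq> 0}"
  have [measurable]: "h \<in> borel_measurable M" using bdd_meas_measurable[OF h(1)] .
  have A: "?A \<in> sets M" by measurable
  have "approx_form t h h \<le> (\<integral>y. indicator ?A y * G t h y \<partial>M) / t"
    by (rule approx_form_le_support[OF t(1) h])
  also have "\<dots> \<le> 1 * (\<integral>y. indicator ?A y \<partial>M) + 1 powr (1 - r) * C"
    by (rule energy_density_bound[OF t(1) h r C besov[OF t(1)] integrable_real_indicator[OF A supp]])
       (auto simp: indicator_def)
  finally show "approx_form t h h \<le> measure M ?A + C"
    using A by simp
qed

end

section \<open>Cut-off functions and singular energy measures\<close>

lemma radon_measureD:
  assumes "radon_measure M"
  shows "sets M = sets borel" "space M = UNIV"
    and "compact S \<Longrightarrow> emeasure M S < \<infinity>"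
    and "A \<in> sets borel \<Longrightarrow> emeasure M A = (INF U\<in>{U. open U \<and> A \<subseteq> U}. emeasure M U)"
    and "open U \<Longrightarrow> emeasure M U = (SUP S\<in>{S. compact S \<and> S \<subseteq> U}. emeasure M S)"
  using assms sets_eq_imp_space_eq[of M borel] unfolding radon_measure_def by auto

text \<open>A Urysohn function need not lie in \<open>F\<close>. A core element \<open>g\<close>
  uniformly within 1/4 of it exceeds 3/4 on \<open>S\<close> and is below 1/4 off \<open>U\<close>.
  Clamping \<open>2 * g - 1 / 2\<close> to the unit interval repairs these values and gives a normal
  contraction of \<open>2 * g\<close>, so the Markov property applies.\<close>

lemma core_cutoff:
  fixes M :: "'a::t2_space measure"
  assumes D: "dirichlet_space M E F" and reg: "regular_form M E F"
    and S: "compact S" and U: "open U" "S \<subseteq> U"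
  shows "\<exists>\<phi>. \<phi> \<in> F \<and> \<phi> \<in> C_c \<and> (\<forall>x. 0 \<le> \<phi> x) \<and> (\<forall>x. \<phi> x \<le> 1) \<and>
    (\<forall>x. x \<in> S \<longrightarrow> \<phi> x = 1) \<and> (\<forall>x. x \<notin> U \<longrightarrow> \<phi> x = 0)"
proof -
  interpret dirichlet_space M E F by (rule D)
  have lc: "locally_compact_space (euclidean :: 'a topology)"
    using reg by (simp add: regular_form_def)
  have haus: "Hausdorff_space (euclidean :: 'a topology)"
    unfolding Hausdorff_space_def disjnt_def by (simp, metis hausdorff)
  have creg: "completely_regular_space (euclidean :: 'a topology)"
    using completely_regular_eq_regular_space[OF lc] locally_compact_Hausdorff_imp_regular_space[OF lc haus]
    by simp
  \<comment> \<open>The compact \<open>L\<close> supplies compact support: the Urysohn function is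
    made to vanish off \<open>W \<inter> U\<close>.\<close>
  obtain W L where WL: "open W" "compact L" "closed L" "S \<subseteq> W" "W \<subseteq> L"
    using lc S unfolding locally_compact_space_compact_closed_compact[OF disjI1[OF haus]] by auto
  obtain \<psi> where \<psi>: "continuous_map euclidean (top_of_set {0..1::real}) \<psi>"
    and \<psi>0: "\<psi> ` (- (W \<inter> U)) \<subseteq> {0}" and \<psi>1: "\<psi> ` S \<subseteq> {1}"
    by (rule Urysohn_completely_regular_compact_closed[OF zero_le_one creg, of S "- (W \<inter> U)"])
       (use S U WL in \<open>auto simp: disjnt_def closed_closedin[symmetric] closed_Compl open_Int\<close>)
  have "\<psi> \<in> C_c"
  proof -
    have "closure {x. \<psi> x \<noteq> 0} \<subseteq> L"
      using \<psi>0 WL(3,5) by (intro closure_minimal) auto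
    then have "compact (closure {x. \<psi> x \<noteq> 0})"
      using compact_Int_closed[OF WL(2), of "closure {x. \<psi> x \<noteq> 0}"] by (simp add: Int_absorb1)
    then show ?thesis
      using \<psi> by (simp add: C_c_def continuous_map_in_subtopology)
  qed
  then obtain g where g: "g \<in> C_c" "g \<in> F" and near: "\<And>x. \<bar>\<psi> x - g x\<bar> < 1 / 4"
    using reg unfolding regular_form_def is_core_def
    by (metis (no_types, lifting) IntD1 IntD2 subsetD zero_less_divide_1_iff zero_less_numeral)
  \<comment> \<open>The affine map sends 1/4 to 0 and 3/4 to 1.\<close>
  define \<phi> where "\<phi> x = max 0 (min 1 (2 * g x - 1 / 2))" for x
  have g2: "(\<lambda>x. 2 * g x) \<in> F" using dom_lin[OF g(2,2), of 2 0] by simp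
  have gm: "g \<in> borel_measurable M" using dom_L2D[OF g(2)] by (simp add: Lp_2_iff)
  show ?thesis
  proof (intro exI[of _ \<phi>] conjI allI impI)
    show "\<phi> \<in> F"
      by (rule conjunct1[OF markovian[OF g2]]) (use gm in \<open>auto simp: \<phi>_def[abs_def]\<close>)
    show "\<phi> \<in> C_c"
    proof -
      have "closure {x. \<phi> x \<noteq> 0} \<subseteq> closure {x. g x \<noteq> 0}"
        by (intro closure_mono) (auto simp: \<phi>_def)
      moreover have "compact (closure {x. g x \<noteq> 0})" using g by (simp add: C_c_def)
      ultimately have "compact (closure {x. \<phi> x \<noteq> 0})"
        using compact_Int_closed[of "closure {x. g x \<noteq> 0}" "closure {x. \<phi> x \<noteq> 0}"] by (simp add: Int_absorb1)
      moreover have "continuous_on UNIV \<phi>"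
        using g unfolding \<phi>_def[abs_def] C_c_def by (auto intro!: continuous_intros)
      ultimately show ?thesis by (simp add: C_c_def)
    qed
    fix x
    show "0 \<le> \<phi> x" "\<phi> x \<le> 1" by (auto simp: \<phi>_def)
    show "\<phi> x = 1" if "x \<in> S"
    proof -
      have "\<psi> x = 1" using \<psi>1 that by auto
      then have "3 / 4 < g x" using near[of x] by linarith
      then show ?thesis by (simp add: \<phi>_def)
    qed
    show "\<phi> x = 0" if "x \<notin> U"
    proof -
      have "\<psi> x = 0" using \<psi>0 that by auto
      then have "g x < 1 / 4" using near[of x] by linarith
      then show ?thesis by (simp add: \<phi>_def)
    qed
  qed
qed

lemma radon_integrable_C_c:
  assumes N: "radon_measure N" and \<phi>: "\<phi> \<in> C_c" "\<And>x. 0 \<le> \<phi> x" "\<And>x. \<phi> x \<le> 1"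
  shows "integrable N \<phi>"
proof -
  let ?S = "closure {x. \<phi> x \<noteq> 0}"
  have sets: "sets N = sets borel" by (rule radon_measureD(1)[OF N])
  have "compact ?S" using \<phi> by (simp add: C_c_def)
  then have fin: "emeasure N ?S < \<infinity>" by (rule radon_measureD(3)[OF N])
  show ?thesis
  proof (rule Bochner_Integration.integrable_bound)
    show "integrable N (indicator ?S :: _ \<Rightarrow> real)"
      using fin sets by (intro integrable_real_indicator) auto
    have "\<phi> \<in> borel_measurable borel"
      using \<phi>(1) by (intro borel_measurable_continuous_onI) (simp add: C_c_def)
    then show "\<phi> \<in> borel_measurable N"
      using measurable_cong_sets[OF sets refl] by blast
    have "\<bar>\<phi> x\<bar> \<le> indicator ?S x" for x
      using \<phi>(2,3)[of x] closure_subset[of "{x. \<phi> x \<noteq> 0}"] by (cases "\<phi> x = 0") (auto simp: indicator_def)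
    then show "AE x in N. norm (\<phi> x) \<le> norm (indicator ?S x :: real)" by simp
  qed
qed

lemma powr_neg_le_imp_nonpos:
  fixes a b c :: real
  assumes c: "c < 0" and le: "\<And>\<kappa>. 0 < \<kappa> \<Longrightarrow> a \<le> \<kappa> powr c * b"
  shows "a \<le> 0"
proof (rule tendsto_lowerbound)
  have "((\<lambda>\<kappa>. \<kappa> powr c * b) \<longlongrightarrow> 0 * b) at_top"
    by (intro tendsto_mult tendsto_const tendsto_neg_powr c filterlim_ident)
  then show "((\<lambda>\<kappa>. \<kappa> powr c * b) \<longlongrightarrow> 0) at_top" by simp
  show "\<forall>\<^sub>F \<kappa> in at_top. a \<le> \<kappa> powr c * b"
    using eventually_gt_at_top[of 0] by eventually_elim (rule le)
qed simp

text \<open>\<open>dom\<close> is a quantitative absolute continuity. \<open>N\<close> is carried by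
  the \<open>M\<close>-null set \<open>- A\<close>; outer regularity of \<open>M\<close> encloses it
  in an open \<open>U\<close> of small measure. Cut-offs carry this smallness over to
  \<open>N\<close> on compact subsets of \<open>U\<close>, and inner regularity to \<open>U\<close>
  itself.\<close>

lemma singular_dominated_null:
  fixes M :: "'a::t2_space measure"
  assumes D: "dirichlet_space M E F" and reg: "regular_form M E F"
    and N: "radon_measure N" and sing: "mutually_singular N M" and r: "1 < r" and C: "0 \<le> C"
    and dom: "\<And>\<phi> \<kappa>. \<lbrakk>\<phi> \<in> F; \<phi> \<in> C_c; \<And>x. 0 \<le> \<phi> x; \<And>x. \<phi> x \<le> 1; 0 < \<kappa>\<rbrakk>
      \<Longrightarrow> (\<integral>x. \<phi> x \<partial>N) \<le> \<kappa> * (\<integral>x. \<phi> x \<partial>M) + \<kappa> powr (1 - r) * C"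
  shows "emeasure N UNIV = 0"
proof -
  have M: "radon_measure M" using reg by (simp add: regular_form_def)
  note sets = radon_measureD(1)[OF M] radon_measureD(1)[OF N]
  note space = radon_measureD(2)[OF M] radon_measureD(2)[OF N]
  obtain A where A: "A \<in> sets borel" "emeasure N A = 0" "emeasure M (- A) = 0"
    using sing sets space by (auto simp: mutually_singular_def Compl_eq_Diff_UNIV)
  have bound: "emeasure N UNIV \<le> ennreal (\<kappa> powr (1 - r) * (1 + C))" if \<kappa>: "0 < \<kappa>" for \<kappa>
  proof -
    \<comment> \<open>Chosen to make \<open>\<kappa> * \<delta>\<close> of the same order as the
      remainder \<open>\<kappa> powr (1 - r) * C\<close>.\<close>
    define \<delta> where "\<delta> = \<kappa> powr - r"
    have \<delta>: "0 < \<delta>" using \<kappa> by (simp add: \<delta>_def)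
    have \<kappa>\<delta>: "\<kappa> * \<delta> = \<kappa> powr (1 - r)" using \<kappa> powr_add[of \<kappa> 1 "- r"] by (simp add: \<delta>_def)
    have "- A \<in> sets borel" using A(1) by auto
    from INF_approx_ennreal[OF \<delta> radon_measureD(4)[OF M this]]
    obtain U where U: "open U" "- A \<subseteq> U" "emeasure M U < ennreal \<delta>"
      using A(3) by auto
    have comp: "emeasure N S \<le> ennreal (\<kappa> powr (1 - r) * (1 + C))" if S: "compact S" "S \<subseteq> U" for S
    proof -
      obtain \<phi> where \<phi>: "\<phi> \<in> F" "\<phi> \<in> C_c" "\<And>x. 0 \<le> \<phi> x" "\<And>x. \<phi> x \<le> 1"
        and \<phi>1: "\<And>x. x \<in> S \<Longrightarrow> \<phi> x = 1" and \<phi>0: "\<And>x. x \<notin> U \<Longrightarrow> \<phi> x = 0"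
        using core_cutoff[OF D reg S(1) U(1) S(2)] by auto
      have "emeasure N S < \<infinity>" by (rule radon_measureD(3)[OF N S(1)])
      moreover have "S \<in> sets N" using sets S(1) by (simp add: borel_closed compact_imp_closed)
      ultimately have iS: "integrable N (indicator S :: 'a \<Rightarrow> real)"
        and eq: "emeasure N S = ennreal (measure N S)"
        by (auto simp: emeasure_eq_ennreal_measure)
      have "measure N S = (\<integral>x. indicator S x \<partial>N)" using \<open>S \<in> sets N\<close> by simp
      also have "\<dots> \<le> (\<integral>x. \<phi> x \<partial>N)"
        using iS radon_integrable_C_c[OF N \<phi>(2-4)] \<phi>1 \<phi>(3) by (intro integral_mono) (auto split: split_indicator)
      also have "\<dots> \<le> \<kappa> * (\<integral>x. \<phi> x \<partial>M) + \<kappa> powr (1 - r) * C"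
        by (rule dom[OF \<phi> \<kappa>])
      also have "(\<integral>x. \<phi> x \<partial>M) \<le> (\<integral>x. indicator U x \<partial>M)"
        using U \<phi>0 \<phi>(4) radon_integrable_C_c[OF M \<phi>(2-4)] sets
        by (intro integral_mono integrable_real_indicator)
           (auto split: split_indicator intro: less_trans[OF _ ennreal_less_top])
      also have "(\<integral>x. indicator U x \<partial>M) \<le> \<delta>"
        using U sets \<delta> by (simp add: measure_def enn2real_leI less_imp_le)
      finally have "measure N S \<le> \<kappa> * \<delta> + \<kappa> powr (1 - r) * C"
        using \<kappa> by (simp add: mult_left_mono)
      then show ?thesis unfolding eq \<kappa>\<delta> by (intro ennreal_leI) (simp add: algebra_simps)
    qed
    have "emeasure N U = (SUP S\<in>{S. compact S \<and> S \<subseteq> U}. emeasure N S)"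
      by (rule radon_measureD(5)[OF N U(1)])
    also have "\<dots> \<le> ennreal (\<kappa> powr (1 - r) * (1 + C))" using comp by (intro SUP_least) auto
    finally have NU: "emeasure N U \<le> ennreal (\<kappa> powr (1 - r) * (1 + C))" .
    have "emeasure N UNIV \<le> emeasure N (A \<union> U)"
      using U(1,2) A(1) sets by (intro emeasure_mono) auto
    also have "\<dots> \<le> emeasure N A + emeasure N U"
      using U(1) A(1) sets by (intro emeasure_subadditive) auto
    finally show ?thesis using NU A(2) by simp
  qed
  \<comment> \<open>\<open>measure\<close> maps infinite mass to 0, so finiteness is secured, from
    level 1, before passing to reals.\<close>
  have fin: "emeasure N UNIV \<noteq> \<infinity>" using bound[of 1] by (auto simp: top_unique)
  have "measure N UNIV \<le> 0"
  proof (rule powr_neg_le_imp_nonpos[of "1 - r" _ "1 + C"])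
    fix \<kappa> :: real assume "0 < \<kappa>"
    then show "measure N UNIV \<le> \<kappa> powr (1 - r) * (1 + C)"
      using bound C by (simp add: measure_def enn2real_leI)
  qed (use r in simp)
  then have "measure N UNIV = 0" using measure_nonneg[of N UNIV] by linarith
  then show ?thesis using fin by (simp add: measure_def enn2real_eq_0_iff)
qed

text \<open>Once \<open>N = 0\<close>, the energy weighted by any cut-off \<open>\<phi>\<close>
  disappears as \<open>t\<close> tends to 0. What remains is weighted by \<open>\<psi>\<close>,
  whose integral is small, and is controlled by the density bound uniformly in \<open>t\<close>;
  only then is \<open>\<kappa>\<close> sent to infinity.\<close>

lemma besov_energy_zero:
  fixes M :: "'a::t2_space measure"
  assumes H: "heat_kernel_space M E F P k" and reg: "regular_form M E F"
    and h: "h \<in> bdd_meas M" "h \<in> F" and r: "1 < r" and C: "0 \<le> C"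
    and besov: "\<And>t. 0 < t \<Longrightarrow>
      (\<integral>\<^sup>+y. (\<integral>\<^sup>+x. ennreal (\<bar>h x - h y\<bar> powr (2 * r)) \<partial>k t y) \<partial>M) \<le> ennreal (C * t powr r)"
    and supp: "emeasure M {x \<in> space M. h x \<noteq> 0} < \<infinity>"
    and N: "bounded_energy_measure E F h N" and sing: "mutually_singular N M"
  shows "E h h = 0"
proof -
  interpret heat_kernel_space M E F P k by (rule H)
  have D: "dirichlet_space M E F" by unfold_locales
  have h2: "h \<in> Lp M 2" by (rule dom_L2D[OF h(2)])
  have M: "radon_measure M" using reg by (simp add: regular_form_def)
  note sets = radon_measureD(1)[OF M] and space = radon_measureD(2)[OF M]
  have NR: "radon_measure N" using N by (simp add: bounded_energy_measure_def)
  have [measurable]: "h \<in> borel_measurable M" using bdd_meas_measurable[OF h(1)] .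
  note bound = energy_density_bound[OF _ h(1) h2 r C besov]
  have cb: "\<phi> \<in> bdd_meas M" if "\<phi> \<in> F" "\<And>x. 0 \<le> \<phi> x" "\<And>x. \<phi> x \<le> 1" for \<phi>
    using that dom_L2D[OF that(1)] by (intro bdd_measI[where B = 1]) (auto simp: Lp_2_iff)
  have lim: "((\<lambda>t. (\<integral>y. \<phi> y * G t h y \<partial>M) / (2 * t)) \<longlongrightarrow> (\<integral>x. \<phi> x \<partial>N)) (at_right 0)"
    if \<phi>: "\<phi> \<in> F" "\<phi> \<in> C_c" "\<And>x. 0 \<le> \<phi> x" "\<And>x. \<phi> x \<le> 1" for \<phi>
  proof -
    have "(\<integral>x. \<phi> x \<partial>N) = E (\<lambda>x. h x * \<phi> x) h - E \<phi> (\<lambda>x. (h x)\<^sup>2) / 2"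
      using N \<phi> by (simp add: bounded_energy_measure_def)
    then show ?thesis using energy_tendsto[OF h cb[OF \<phi>(1,3,4)] \<phi>(1)] by simp
  qed
  have "emeasure N UNIV = 0"
  proof (rule singular_dominated_null[OF D reg NR sing r C])
    fix \<phi> :: "'a \<Rightarrow> real" and \<kappa> :: real
    assume \<phi>: "\<phi> \<in> F" "\<phi> \<in> C_c" "\<And>x. 0 \<le> \<phi> x" "\<And>x. \<phi> x \<le> 1" and \<kappa>: "0 < \<kappa>"
    have "(\<integral>y. \<phi> y * G t h y \<partial>M) / (2 * t) \<le> \<kappa> * (\<integral>x. \<phi> x \<partial>M) + \<kappa> powr (1 - r) * C" if t: "0 < t" for t
    proof -
      have "0 \<le> (\<integral>y. \<phi> y * G t h y \<partial>M)"
        using \<phi>(3) G_nonneg by (intro integral_nonneg_AE) auto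
      then have "(\<integral>y. \<phi> y * G t h y \<partial>M) / (2 * t) \<le> (\<integral>y. \<phi> y * G t h y \<partial>M) / t"
        using t by (intro divide_left_mono) auto
      also have "\<dots> \<le> \<kappa> * (\<integral>x. \<phi> x \<partial>M) + \<kappa> powr (1 - r) * C"
        by (rule bound[OF t t radon_integrable_C_c[OF M \<phi>(2-4)] \<phi>(3,4) \<kappa>])
      finally show ?thesis .
    qed
    then have "\<forall>\<^sub>F t in at_right 0. (\<integral>y. \<phi> y * G t h y \<partial>M) / (2 * t) \<le> \<kappa> * (\<integral>x. \<phi> x \<partial>M) + \<kappa> powr (1 - r) * C"
      using eventually_at_right_less[of 0] by (auto elim: eventually_mono)
    then show "(\<integral>x. \<phi> x \<partial>N) \<le> \<kappa> * (\<integral>x. \<phi> x \<partial>M) + \<kappa> powr (1 - r) * C"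
      using tendsto_upperbound[OF lim[OF \<phi>]] by simp
  qed
  then have "UNIV \<in> null_sets N"
    using radon_measureD(1)[OF NR] by (intro null_setsI) auto
  then have N0: "(\<integral>x. \<phi> x \<partial>N) = 0" for \<phi> :: "'a \<Rightarrow> real"
    by (intro integral_eq_zero_AE AE_I'[of UNIV]) auto
  let ?A = "{x. h x \<noteq> 0}"
  have A: "?A \<in> sets M" and Afin: "emeasure M ?A < \<infinity>"
    using supp space borel_measurable_neq[of h M "\<lambda>_. 0"] by auto
  \<comment> \<open>\<open>radon_measure\<close> gives approximation by compact sets from inside for
    open sets only, so the support is first enclosed in an open set of finite measure.\<close>
  have "emeasure M ?A = (INF U\<in>{U. open U \<and> ?A \<subseteq> U}. emeasure M U)"
    using radon_measureD(4)[OF M, of ?A] A sets by simp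
  with Afin obtain U where U: "open U" "?A \<subseteq> U" "emeasure M U < \<infinity>"
    by (auto simp: INF_less_iff)
  have "E h h \<le> \<kappa> powr (1 - r) * (1 + C)" if \<kappa>: "0 < \<kappa>" for \<kappa>
  proof -
    define \<delta> where "\<delta> = \<kappa> powr - r"
    have \<delta>: "0 < \<delta>" using \<kappa> by (simp add: \<delta>_def)
    have \<kappa>\<delta>: "\<kappa> * \<delta> = \<kappa> powr (1 - r)" using \<kappa> powr_add[of \<kappa> 1 "- r"] by (simp add: \<delta>_def)
    have "{S. compact S \<and> S \<subseteq> U} \<noteq> {}" by (auto intro: exI[of _ "{}"])
    from SUP_approx_ennreal[OF \<delta> this radon_measureD(5)[OF M U(1)]]
    obtain S where S: "compact S" "S \<subseteq> U" "emeasure M U < emeasure M S + ennreal \<delta>"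
      using less_imp_neq[OF U(3)] by auto
    have mS: "S \<in> sets M" and mU: "U \<in> sets M"
      using sets S(1) U(1) by (auto simp: borel_closed compact_imp_closed)
    obtain \<phi> where \<phi>: "\<phi> \<in> F" "\<phi> \<in> C_c" "\<And>x. 0 \<le> \<phi> x" "\<And>x. \<phi> x \<le> 1"
      and \<phi>1: "\<And>x. x \<in> S \<Longrightarrow> \<phi> x = 1" and \<phi>0: "\<And>x. x \<notin> U \<Longrightarrow> \<phi> x = 0"
      using core_cutoff[OF D reg S(1) U(1) S(2)] by auto
    \<comment> \<open>The density bound accepts any integrable weight with values in the unit
      interval, so \<open>\<psi>\<close> may fail to lie in \<open>F\<close>.\<close>
    define \<psi> where "\<psi> x = indicator U x - \<phi> x" for x
    have i\<phi>: "integrable M \<phi>" by (rule radon_integrable_C_c[OF M \<phi>(2-4)])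
    have iU: "integrable M (indicator U :: 'a \<Rightarrow> real)" using mU U(3) by simp
    have \<psi>: "integrable M \<psi>" "0 \<le> \<psi> x" "\<psi> x \<le> 1" for x
      using i\<phi> iU \<phi>(3,4)[of x] \<phi>0[of x] by (auto simp: \<psi>_def[abs_def] split: split_indicator)
    have int\<psi>: "(\<integral>x. \<psi> x \<partial>M) \<le> \<delta>"
    proof -
      have fin: "emeasure M S < \<infinity>" by (rule radon_measureD(3)[OF M S(1)])
      have iS: "integrable M (indicator S :: 'a \<Rightarrow> real)" using mS fin by simp
      have "(\<integral>x. \<psi> x \<partial>M) \<le> (\<integral>x. indicator U x - indicator S x \<partial>M)"
        using \<psi>(1) i\<phi> iU iS \<phi>1 \<phi>(3) by (intro integral_mono) (auto simp: \<psi>_def split: split_indicator)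
      also have "\<dots> = measure M U - measure M S" using iU iS mU mS by simp
      also have "\<dots> \<le> \<delta>"
      proof -
        have "ennreal (measure M U) < ennreal (measure M S) + ennreal \<delta>"
          using S(3) fin U(3) by (simp add: emeasure_eq_ennreal_measure)
        then have "ennreal (measure M U) < ennreal (measure M S + \<delta>)"
          using \<delta> by (simp add: ennreal_plus)
        then have "measure M U < measure M S + \<delta>"
          by (simp add: ennreal_less_iff)
        then show ?thesis by simp
      qed
      finally show ?thesis .
    qed
    \<comment> \<open>The factor 2 arises because \<open>approx_form_le_support\<close> divides by
      \<open>t\<close>, the energy quotients by \<open>2 * t\<close>.\<close>
    have "approx_form t h h \<le> 2 * ((\<integral>y. \<phi> y * G t h y \<partial>M) / (2 * t)) + \<kappa> powr (1 - r) * (1 + C)"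
      if t: "0 < t" for t
    proof -
      have t0: "0 \<le> t" using t by simp
      note iG = G_integrable[OF t0 h(1) h2]
      have ints: "integrable M (\<lambda>y. \<phi> y * G t h y)" "integrable M (\<lambda>y. \<psi> y * G t h y)"
        "integrable M (\<lambda>y. indicator ?A y * G t h y)"
        using \<phi>(3,4) \<psi> i\<phi> A
        by (auto intro!: bdd_meas_mult_integrable[OF _ iG] bdd_measI[where B = 1] cb[OF \<phi>(1)]
                 simp: indicator_def abs_le_iff intro: order_trans)
      have "approx_form t h h \<le> (\<integral>y. indicator ?A y * G t h y \<partial>M) / t"
        using approx_form_le_support[OF t h(1) h2] by (simp add: space)
      also have "(\<integral>y. indicator ?A y * G t h y \<partial>M) \<le> (\<integral>y. \<phi> y * G t h y + \<psi> y * G t h y \<partial>M)"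
      proof (rule integral_mono)
        fix y
        have "indicator ?A y \<le> \<phi> y + \<psi> y" using U(2) by (auto simp: \<psi>_def indicator_def)
        then have "indicator ?A y * G t h y \<le> (\<phi> y + \<psi> y) * G t h y"
          by (intro mult_right_mono G_nonneg)
        then show "indicator ?A y * G t h y \<le> \<phi> y * G t h y + \<psi> y * G t h y"
          by (simp add: distrib_right)
      qed (use ints in auto)
      also have "\<dots> = (\<integral>y. \<phi> y * G t h y \<partial>M) + (\<integral>y. \<psi> y * G t h y \<partial>M)"
        using ints by simp
      finally have "approx_form t h h \<le> ((\<integral>y. \<phi> y * G t h y \<partial>M) + (\<integral>y. \<psi> y * G t h y \<partial>M)) / t"
        using t by (simp add: divide_right_mono)
      moreover have "(\<integral>y. \<psi> y * G t h y \<partial>M) / t \<le> \<kappa> * (\<integral>x. \<psi> x \<partial>M) + \<kappa> powr (1 - r) * C"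
        by (rule bound[OF t t \<psi> \<kappa>])
      moreover have "\<kappa> * (\<integral>x. \<psi> x \<partial>M) \<le> \<kappa> powr (1 - r)"
        unfolding \<kappa>\<delta>[symmetric] using int\<psi> \<kappa> by (intro mult_left_mono) auto
      ultimately show ?thesis by (simp add: add_divide_distrib distrib_left)
    qed
    then have "\<forall>\<^sub>F t in at_right 0. approx_form t h h
        \<le> 2 * ((\<integral>y. \<phi> y * G t h y \<partial>M) / (2 * t)) + \<kappa> powr (1 - r) * (1 + C)"
      using eventually_at_right_less[of 0] by (auto elim: eventually_mono)
    moreover have "((\<lambda>t. 2 * ((\<integral>y. \<phi> y * G t h y \<partial>M) / (2 * t)) + \<kappa> powr (1 - r) * (1 + C))
        \<longlongrightarrow> 2 * 0 + \<kappa> powr (1 - r) * (1 + C)) (at_right 0)"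
      using lim[OF \<phi>] unfolding N0 by (intro tendsto_intros)
    ultimately have "E h h \<le> 2 * 0 + \<kappa> powr (1 - r) * (1 + C)"
      by (intro tendsto_le[OF _ _ approx_form_tendsto[OF h(2,2)]]) auto
    then show ?thesis by simp
  qed
  then have "E h h \<le> 0"
    using powr_neg_le_imp_nonpos[of "1 - r" "E h h" "1 + C"] r by simp
  then show ?thesis using form_nonneg[OF h(2)] by simp
qed

section \<open>Besov functions\<close>

lemma besov_bound:
  assumes f: "f \<in> besov_space M k p (1 / 2)" and p: "0 < p"
  shows "\<exists>C\<ge>0. \<forall>t>0.
    (\<integral>\<^sup>+y. (\<integral>\<^sup>+x. ennreal (\<bar>f x - f y\<bar> powr p) \<partial>k t y) \<partial>M) \<le> ennreal (C * t powr (p / 2))"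
proof -
  define s where "s = enn2real (besov_seminorm M k p (1 / 2) f)"
  have s: "besov_seminorm M k p (1 / 2) f = ennreal s" and s0: "0 \<le> s"
    using f by (simp_all add: s_def besov_space_def)
  have "(\<integral>\<^sup>+y. (\<integral>\<^sup>+x. ennreal (\<bar>f x - f y\<bar> powr p) \<partial>k t y) \<partial>M) \<le> ennreal (s powr p * t powr (p / 2))"
    if t: "0 < t" for t
  proof -
    define I where "I = (\<integral>\<^sup>+y. (\<integral>\<^sup>+x. ennreal (\<bar>f x - f y\<bar> powr p) \<partial>k t y) \<partial>M)"
    have le: "ennreal (t powr - (1 / 2)) * ennreal_powr I (1 / p) \<le> ennreal s"
      unfolding s[symmetric] besov_seminorm_def I_def using t by (intro SUP_upper) auto
    \<comment> \<open>\<open>ennreal_powr\<close> preserves infinity, and a positive multiple of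
      infinity would exceed the finite \<open>s\<close>.\<close>
    have fin: "I \<noteq> \<infinity>"
    proof
      assume "I = \<infinity>"
      then have "ennreal (t powr - (1 / 2)) * \<infinity> \<le> ennreal s" using le by (simp add: ennreal_powr_def)
      then show False using t by (simp add: ennreal_mult_top top_unique)
    qed
    define i where "i = enn2real I"
    have i: "I = ennreal i" "0 \<le> i" using fin by (simp_all add: i_def less_top)
    have "t powr - (1 / 2) * i powr (1 / p) \<le> s"
      using le fin s0 by (simp add: ennreal_powr_def i_def ennreal_mult[symmetric])
    then have "t powr (1 / 2) * (t powr - (1 / 2) * i powr (1 / p)) \<le> t powr (1 / 2) * s"
      by (intro mult_left_mono) auto
    then have "i powr (1 / p) \<le> t powr (1 / 2) * s"
      using t by (simp add: mult.assoc[symmetric] powr_add[symmetric])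
    then have "(i powr (1 / p)) powr p \<le> (t powr (1 / 2) * s) powr p"
      using p by (intro powr_mono2) auto
    then have "i \<le> s powr p * t powr (p / 2)"
      using p i(2) s0 t by (simp add: powr_powr powr_mult mult.commute)
    then show ?thesis unfolding I_def[symmetric] i(1) by (intro ennreal_leI)
  qed
  then show ?thesis by (intro exI[of _ "s powr p"]) simp
qed

section \<open>Truncations of Besov functions\<close>

definition clip :: "real \<Rightarrow> real \<Rightarrow> real" where
  "clip c a = max (- c) (min c a)"

lemma clip_lipschitz: "\<bar>clip c a - clip c b\<bar> \<le> \<bar>a - b\<bar>"
  by (auto simp: clip_def max_def min_def)

lemma clip_bounded: "0 \<le> c \<Longrightarrow> \<bar>clip c a\<bar> \<le> c"
  by (auto simp: clip_def)

text \<open>The map \<open>a \<mapsto> a - clip \<epsilon> a\<close> shrinks towards 0, which makes the support of finite measure;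
  the outer clipping makes the function bounded.\<close>

definition truncate :: "real \<Rightarrow> real \<Rightarrow> real \<Rightarrow> real" where
  "truncate \<epsilon> n a = clip n (a - clip \<epsilon> a)"

lemma truncate_lipschitz: "\<bar>truncate \<epsilon> n a - truncate \<epsilon> n b\<bar> \<le> \<bar>a - b\<bar>"
proof -
  have "\<bar>(a - clip \<epsilon> a) - (b - clip \<epsilon> b)\<bar> \<le> \<bar>a - b\<bar>"
    by (auto simp: clip_def max_def min_def)
  then show ?thesis
    unfolding truncate_def using clip_lipschitz order_trans by blast
qed

lemma truncate_eq_0: "\<lbrakk>\<bar>a\<bar> \<le> \<epsilon>; 0 \<le> n\<rbrakk> \<Longrightarrow> truncate \<epsilon> n a = 0"
  by (auto simp: truncate_def clip_def)

lemma truncate_close: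
  assumes "0 \<le> \<epsilon>" "\<bar>a\<bar> \<le> n"
  shows "\<bar>truncate \<epsilon> n a - a\<bar> \<le> \<epsilon>"
  using assms by (auto simp: truncate_def clip_def max_def min_def)

lemma Lp_superlevel_finite:
  assumes f: "f \<in> Lp M p" and p: "0 < p" and e: "0 < e"
  shows "emeasure M {x \<in> space M. e < \<bar>f x\<bar>} < \<infinity>"
proof -
  have [measurable]: "f \<in> borel_measurable M" and int: "integrable M (\<lambda>x. \<bar>f x\<bar> powr p)"
    using f by (auto simp: Lp_def)
  have sub: "{x \<in> space M. e < \<bar>f x\<bar>} \<subseteq> {x \<in> space M. e powr p \<le> \<bar>f x\<bar> powr p}"
    using e p by (auto intro: powr_mono2)
  have "emeasure M {x \<in> space M. e < \<bar>f x\<bar>} \<le> emeasure M {x \<in> space M. e powr p \<le> \<bar>f x\<bar> powr p}"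
    by (rule emeasure_mono[OF sub]) measurable
  also have "\<dots> \<le> ennreal (1 / e powr p * (\<integral>x. \<bar>f x\<bar> powr p \<partial>M))"
    by (rule integral_Markov_inequality[OF int]) (use e in auto)
  also have "\<dots> < \<infinity>" by simp
  finally show ?thesis .
qed

lemma ae_constant_limit:
  assumes const: "\<And>n. ae_constant M (\<lambda>x. h n x)"
    and lim: "\<And>x. (\<lambda>n. h n x) \<longlonglongrightarrow> f x"
  shows "ae_constant M f"
proof -
  obtain c where "\<And>n. AE x in M. h n x = c n"
    using const unfolding ae_constant_def by metis
  then have ae: "AE x in M. \<forall>n. h n x = c n" by (simp add: AE_all_countable)
  \<comment> \<open>Convergence of \<open>c\<close> need not be shown beforehand: any point where
    all \<open>h n\<close> take their constant values provides it.\<close>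
  have "AE x in M. f x = lim c"
    using ae
  proof eventually_elim
    case (elim x)
    then have "(\<lambda>n. h n x) = c" by auto
    then show ?case using lim[of x] limI by fastforce
  qed
  then show ?thesis by (auto simp: ae_constant_def)
qed

theorem corollary4p13:
  fixes M :: "'a::t2_space measure"
    and E :: "('a \<Rightarrow> real) \<Rightarrow> ('a \<Rightarrow> real) \<Rightarrow> real"
    and F :: "('a \<Rightarrow> real) set"
    and P :: "real \<Rightarrow> ('a \<Rightarrow> real) \<Rightarrow> 'a \<Rightarrow> real"
    and k :: "real \<Rightarrow> 'a \<Rightarrow> 'a measure"
    and \<nu> :: "('a \<Rightarrow> real) \<Rightarrow> 'a measure"
    and p :: real
  assumes "good_measurable_space M"
    and "dirichlet_space M E F"
    and "heat_semigroup M E F P"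
    and "conservative M P"
    and "heat_kernel M P k"
    and "\<And>f. \<lbrakk>f \<in> F; E f f = 0\<rbrakk> \<Longrightarrow> ae_constant M f"
    and "regular_form M E F"
    and "\<And>f. f \<in> F \<Longrightarrow> energy_measure M E F f (\<nu> f)"
    and "\<And>f. \<lbrakk>f \<in> F; \<not> ae_constant M f\<rbrakk> \<Longrightarrow> mutually_singular (\<nu> f) M"
    and "2 < p"
  shows "\<forall>f \<in> besov_space M k p (1 / 2). ae_constant M f"
proof
  fix f assume f: "f \<in> besov_space M k p (1 / 2)"
  interpret S: heat_semigroup M E F P by (rule assms(3))
  have H: "heat_kernel_space M E F P k"
    by unfold_locales (rule assms(5))
  interpret H: heat_kernel_space M E F P k by (rule H)
  have p: "0 < p" "1 < p / 2" using assms(10) by simp_all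
  have fp: "f \<in> Lp M p" and fm[measurable]: "f \<in> borel_measurable M"
    using f by (auto simp: besov_space_def Lp_def)
  obtain C where C: "0 \<le> C"
    and fC: "\<And>t. 0 < t \<Longrightarrow> (\<integral>\<^sup>+y. (\<integral>\<^sup>+x. ennreal (\<bar>f x - f y\<bar> powr p) \<partial>k t y) \<partial>M)
        \<le> ennreal (C * t powr (p / 2))"
    using besov_bound[OF f p(1)] by blast
  have "ae_constant M (\<lambda>x. truncate e N (f x))" if e: "0 < e" and N: "0 \<le> N" for e N
  \<comment> \<open>Singularity is assumed only for non-constant functions. Under that assumption
    the energy of \<open>h\<close> vanishes, which makes \<open>h\<close> constant after
    all.\<close>
  proof (rule ccontr)
    define h where "h = (\<lambda>x. truncate e N (f x))"
    assume "\<not> ae_constant M (\<lambda>x. truncate e N (f x))"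
    then have nc: "\<not> ae_constant M h" by (simp add: h_def)
    have hm[measurable]: "h \<in> borel_measurable M"
      unfolding h_def truncate_def clip_def by measurable
    have hb: "h \<in> bdd_meas M"
      by (rule bdd_measI[OF hm, of N]) (simp add: h_def truncate_def clip_bounded[OF N])
    have supp: "emeasure M {x \<in> space M. h x \<noteq> 0} < \<infinity>"
    proof -
      have "emeasure M {x \<in> space M. h x \<noteq> 0} \<le> emeasure M {x \<in> space M. e < \<bar>f x\<bar>}"
        by (rule emeasure_mono) (use truncate_eq_0[OF _ N, of _ e] in \<open>auto simp: h_def not_less[symmetric]\<close>)
      also have "\<dots> < \<infinity>" by (rule Lp_superlevel_finite[OF fp p(1) e])
      finally show ?thesis .
    qed
    have h2: "h \<in> Lp M 2"
    proof -
      have iA: "integrable M (indicator {x \<in> space M. h x \<noteq> 0} :: _ \<Rightarrow> real)"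
        using supp by (intro integrable_real_indicator) auto
      have "integrable M (\<lambda>x. (h x)\<^sup>2 * indicator {x \<in> space M. h x \<noteq> 0} x)"
        by (rule bdd_meas_mult_integrable[OF bdd_meas_square[OF hb] iA])
      then have "integrable M (\<lambda>x. (h x)\<^sup>2)"
        by (subst Bochner_Integration.integrable_cong[OF refl, where g = "\<lambda>x. (h x)\<^sup>2 * indicator {x \<in> space M. h x \<noteq> 0} x"])
           (auto simp: indicator_def)
      then show ?thesis by (simp add: Lp_2_iff)
    qed
    have besov: "(\<integral>\<^sup>+y. (\<integral>\<^sup>+x. ennreal (\<bar>h x - h y\<bar> powr (2 * (p / 2))) \<partial>k t y) \<partial>M)
        \<le> ennreal (C * t powr (p / 2))" if t: "0 < t" for t
    proof -
      have "(\<integral>\<^sup>+y. (\<integral>\<^sup>+x. ennreal (\<bar>h x - h y\<bar> powr (2 * (p / 2))) \<partial>k t y) \<partial>M)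
          \<le> (\<integral>\<^sup>+y. (\<integral>\<^sup>+x. ennreal (\<bar>f x - f y\<bar> powr p) \<partial>k t y) \<partial>M)"
        using p(1) truncate_lipschitz
        by (intro nn_integral_mono ennreal_leI) (auto simp: h_def intro!: powr_mono2)
      also have "\<dots> \<le> ennreal (C * t powr (p / 2))" by (rule fC[OF t])
      finally show ?thesis .
    qed
    have hF: "h \<in> F" by (rule H.dom_if_besov_bound[OF hb h2 p(2) C besov supp])
    have "bounded_energy_measure E F h (\<nu> h)"
      using assms(8)[OF hF] bdd_meas_Linf[OF hb] by (simp add: energy_measure_def)
    then have "E h h = 0"
      using assms(9)[OF hF nc]
      by (intro besov_energy_zero[OF H assms(7) hb hF p(2) C besov supp, where N = "\<nu> h"]) auto
    then show False using assms(6)[OF hF] nc by blast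
  qed
  \<comment> \<open>Both parameters move together: the lower cut-off stays positive and tends to 0,
    while the upper one eventually exceeds \<open>\<bar>f x\<bar>\<close> at each point.\<close>
  then have const: "ae_constant M (\<lambda>x. truncate (1 / real (Suc n)) (real n) (f x))" for n
    by simp
  show "ae_constant M f"
  proof (rule ae_constant_limit[OF const])
    fix x
    have "(\<lambda>n. truncate (1 / real (Suc n)) (real n) (f x) - f x) \<longlonglongrightarrow> 0"
    proof (rule Lim_null_comparison)
      show "(\<lambda>n. 1 / real (Suc n)) \<longlonglongrightarrow> 0" by (intro LIMSEQ_Suc lim_1_over_n)
      show "\<forall>\<^sub>F n in sequentially. norm (truncate (1 / real (Suc n)) (real n) (f x) - f x) \<le> 1 / real (Suc n)"
        using eventually_ge_at_top[of "nat \<lceil>\<bar>f x\<bar>\<rceil>"]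
      proof eventually_elim
        case (elim n)
        have "\<bar>f x\<bar> \<le> real n" using elim by linarith
        then have "\<bar>truncate (1 / real (Suc n)) (real n) (f x) - f x\<bar> \<le> 1 / real (Suc n)"
          by (intro truncate_close) auto
        then show ?case by (simp only: real_norm_def)
      qed
    qed
    then show "(\<lambda>n. truncate (1 / real (Suc n)) (real n) (f x)) \<longlonglongrightarrow> f x"
      by (simp add: LIM_zero_iff)
  qed
qed

end
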